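(* Let $(a_{nk})_{n,k\ge0}$ be complex scalars with $\sum_{k\ge0}|a_{nk}|<\infty$ for each $n\ge0$. Then the following are equivalent: (i) $\sum_{k\ge0}a_{nk}\hat f(k)z^k\to f$ weakly in $A(\mathbb D)$, for all $f\in A(\mathbb D)$; (ii) $\sum_{k\ge0}a_{nk}\hat f(k)z^k\to f$ in sup-norm, for all $f\in A(\mathbb D)$; (iii) $\sum_{k\ge0}a_{nk}\hat\mu(k)z^k\to K\mu$ weak* in $\mathcal K$, for all $\mu\in M(\mathbb T)$; (iv) $\sum_{k\ge0}a_{nk}\hat g(k)z^k\to Kg$ weak* in $\mathcal K$, for all $g\in L^1(\mathbb T)$; (v) for all $g\in L^1(\mathbb T)$, $\operatorname{dist}_{L^1}\bigl(\sum_{k\ge0}a_{nk}\hat g(k)e^{ikt}-g,\ \overline{H^1_0}\bigr)\to0$, i.e. the classes converge in the quotient norm of $L^1(\mathbb T)/\overline{H^1_0}$.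
   Context: $A(\mathbb D)$ is the disk algebra (holomorphic functions on the unit disk $\mathbb D$ continuous on $\overline{\mathbb D}$) with sup-norm, and $\hat f(k)$ are Taylor coefficients. $M(\mathbb T)$ is the space of finite complex Borel measures on the unit circle, $\hat\mu(k)=\int\overline\zeta^k d\mu(\zeta)$, and $L^1(\mathbb T)$ is identified with measures $g\,dt/2\pi$. $\overline{H^1_0}:=\{h\in L^1(\mathbb T):\hat h(k)=0\ \forall k\ge0\}$. The Cauchy transform is $K\mu(z):=\int_{\mathbb T}\frac{d\mu(\zeta)}{1-\overline\zeta z}=\sum_{k\ge0}\hat\mu(k)z^k$, and $\mathcal K:=\{K\mu:\mu\in M(\mathbb T)\}$ with norm $\|K\mu\|_{\mathcal K}:=\operatorname{dist}(\mu,\overline{H^1_0})$ (total variation). $\mathcal K$ is identified with $A(\mathbb D)^*$ via $\langle f,K\mu\rangle=\int_{\mathbb T}f(\zeta)\,d\mu(\overline\zeta)=\lim_{r\to1^-}\sum_{k\ge0}\hat f(k)\hat\mu(k)r^k$; weak* refers to this duality. A polynomial $\sum_k c_kz^k$ is regarded as the element $K(\sum_kc_ke^{ikt}dt/2\pi)$ of $\mathcal K$. *)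

theory Defs
  imports "HOL-Analysis.Analysis" "HOL-Complex_Analysis.Complex_Analysis"
begin

text \<open>Elements of A(D) are represented by functions holomorphic on the open unit disk
  and continuous on the closed unit disk (values off the closed disk are irrelevant).\<close>
definition disk_algebra :: "(complex \<Rightarrow> complex) set" where
  "disk_algebra = {f. f holomorphic_on ball 0 1 \<and> continuous_on (cball 0 1) f}"

definition sup_norm :: "(complex \<Rightarrow> complex) \<Rightarrow> real" where
  "sup_norm f = (SUP z\<in>cball 0 1. norm (f z))"

definition taylor_coeff :: "(complex \<Rightarrow> complex) \<Rightarrow> nat \<Rightarrow> complex" where
  "taylor_coeff f k = (deriv ^^ k) f 0 / fact k"

definition bounded_functional_A :: "((complex \<Rightarrow> complex) \<Rightarrow> complex) \<Rightarrow> bool" where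
  "bounded_functional_A L \<longleftrightarrow>
     (\<forall>f\<in>disk_algebra. \<forall>g\<in>disk_algebra. L (\<lambda>z. f z + g z) = L f + L g) \<and>
     (\<forall>c. \<forall>f\<in>disk_algebra. L (\<lambda>z. c * f z) = c * L f) \<and>
     (\<exists>C. \<forall>f\<in>disk_algebra. norm (L f) \<le> C * sup_norm f)"

definition weakly_conv_A :: "(nat \<Rightarrow> complex \<Rightarrow> complex) \<Rightarrow> (complex \<Rightarrow> complex) \<Rightarrow> bool" where
  "weakly_conv_A F f \<longleftrightarrow>
     (\<forall>L. bounded_functional_A L \<longrightarrow> (\<lambda>n. L (F n)) \<longlonglongrightarrow> L f)"

text \<open>A finite complex Borel measure \<mu> on T is represented via its polar decomposition
  d\<mu> = h d\<nu> with \<nu> a finite positive Borel measure on the unit circle and h \<in> L^1(\<nu>).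
  Every complex measure arises this way (take \<nu> = |\<mu>|).\<close>
definition cmeasure_T :: "complex measure \<Rightarrow> (complex \<Rightarrow> complex) \<Rightarrow> bool" where
  "cmeasure_T \<nu> h \<longleftrightarrow> finite_measure \<nu> \<and>
     sets \<nu> = sets (restrict_space borel (sphere (0::complex) 1)) \<and> integrable \<nu> h"

definition meas_coeff :: "complex measure \<Rightarrow> (complex \<Rightarrow> complex) \<Rightarrow> nat \<Rightarrow> complex" where
  "meas_coeff \<nu> h k = (\<integral>\<zeta>. cnj \<zeta> ^ k * h \<zeta> \<partial>\<nu>)"

text \<open>The duality pairing <f, K\<mu>> = \<integral> f(\<zeta>) d\<mu>(conj \<zeta>) = \<integral> f(conj \<zeta>) d\<mu>(\<zeta>).\<close>
definition meas_pair :: "(complex \<Rightarrow> complex) \<Rightarrow> complex measure \<Rightarrow> (complex \<Rightarrow> complex) \<Rightarrow> complex" where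
  "meas_pair f \<nu> h = (\<integral>\<zeta>. f (cnj \<zeta>) * h \<zeta> \<partial>\<nu>)"

definition L1T :: "(real \<Rightarrow> complex) \<Rightarrow> bool" where
  "L1T g \<longleftrightarrow> integrable (lebesgue_on {0..2*pi}) g"

definition L1_coeff :: "(real \<Rightarrow> complex) \<Rightarrow> nat \<Rightarrow> complex" where
  "L1_coeff g k = (\<integral>t. g t * cis (- (real k * t)) \<partial>lebesgue_on {0..2*pi}) / complex_of_real (2*pi)"

definition L1_pair :: "(complex \<Rightarrow> complex) \<Rightarrow> (real \<Rightarrow> complex) \<Rightarrow> complex" where
  "L1_pair f g = (\<integral>t. f (cis (- t)) * g t \<partial>lebesgue_on {0..2*pi}) / complex_of_real (2*pi)"

definition L1_norm :: "(real \<Rightarrow> complex) \<Rightarrow> real" where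
  "L1_norm g = (\<integral>t. norm (g t) \<partial>lebesgue_on {0..2*pi}) / (2*pi)"

definition H10_conj :: "(real \<Rightarrow> complex) set" where
  "H10_conj = {h. L1T h \<and> (\<forall>k. L1_coeff h k = 0)}"

definition quot_norm :: "(real \<Rightarrow> complex) \<Rightarrow> real" where
  "quot_norm g = (INF h\<in>H10_conj. L1_norm (\<lambda>t. g t - h t))"

end

theory Submission
  imports Defs
begin

text \<open>
  Condition (ii) gives (i), and (i) gives (iii), because bounded functionals and measures act on the
  disk algebra; (iii) gives (iv) by splitting g into positive parts, and (v) gives (iv) because the
  pairing with the disk algebra factors through the quotient. Assuming (iv), Banach--Steinhaus, applied first on
  the disk algebra and then on L1, bounds the multiplier operators uniformly in n (Fejer kernels
  recover the sup-norm from the pairing with L1); testing on exponentials gives a_nk \<rightarrow> 1, and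
  density of polynomials yields (ii).

  For (v) the uniform bound must be carried over to the quotient norm of L1. This needs that, on
  absolutely convergent analytic series, the quotient norm is at most the norm as a functional on the
  disk algebra. The functional is extended by a finite-dimensional Hahn--Banach argument from analytic
  to all trigonometric polynomials of degree M; the Fejer means of the extended coefficients have L1
  norm at most that of the functional, and their analytic parts differ from the original series only
  by a Cesaro error that vanishes as M \<rightarrow> \<infinity>. Since trigonometric polynomials are dense in
  L1, (v) follows.
\<close>

section \<open>Hahn--Banach in finite steps, Cesaro means, Banach--Steinhaus\<close>

text \<open>Weak conditions can force norm convergence because the operators are Taylor multipliers:
  on a polynomial they act through finitely many scalars a_nk, so once these tend to 1, only a bound
  uniform in n is missing. The obstacle is (v). L1 modulo \<open>H10_conj\<close> embeds in the dual
  of A(D), and that the embedding is isometric is usually read off from a representing measure of a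
  Hahn-Banach extension. Here Fejer means of the extended coefficients stand in for that measure.
  They see only finitely many frequencies, so an extension in finitely many steps suffices; the
  price is a Cesaro error, controlled by absolute summability of a_nk times the coefficients of g.
  Fejer sums are written throughout as double sums over j, l \<le> M with frequency j - l: the
  kernel is then visibly a squared modulus, which gives its positivity and with it its L1 norm 1,
  and the multiplicity M + 1 - |m| of a frequency never has to be computed.\<close>

lemma hahn_banach_step:
  fixes p u :: "'a::real_vector \<Rightarrow> real"
  assumes tri: "\<And>x y. p (x + y) \<le> p x + p y"
    and hom: "\<And>c x. c > 0 \<Longrightarrow> p (c *\<^sub>R x) = c * p x"
    and S: "subspace S" and u: "linear u" and le: "\<And>x. x \<in> S \<Longrightarrow> u x \<le> p x"
  shows "\<exists>u'. linear u' \<and> (\<forall>x\<in>S. u' x = u x) \<and> (\<forall>x\<in>span (insert v S). u' x \<le> p x)"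
proof (cases "v \<in> S")
  case True
  then have "insert v S = S" by blast
  then have "span (insert v S) = S"
    using S by (simp add: span_eq_iff)
  then show ?thesis using u le by blast
next
  case False
  interpret u: linear u by (rule u)
  obtain B where B: "B \<subseteq> S" "independent B" "S \<subseteq> span B"
    by (rule basis_exists)
  then have "span B = S"
    using S span_minimal by blast
  then have "independent (insert v B)"
    using B False by (simp add: independent_insert)
  \<comment> \<open>w is the coordinate along v: it is 1 at v and 0 on S, so adding a multiple of w
    adjusts the value at v and changes nothing on S.\<close>
  then obtain w :: "'a \<Rightarrow> real"
    where w: "linear w" and wB: "\<And>x. x \<in> insert v B \<Longrightarrow> w x = (if x = v then 1 else 0)"
    using linear_independent_extend[of "insert v B" "\<lambda>x. if x = v then 1 else 0"] by metis
  interpret w: linear w by (rule w)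
  have wv: "w v = 1" using wB by simp
  have wS: "w x = 0" if "x \<in> S" for x
  proof (rule linear_eq_0_on_span[OF w])
    show "w x = 0" if "x \<in> B" for x using wB[of x] that B(1) False by auto
  qed (use that \<open>span B = S\<close> in simp)
  define E where "E = (\<lambda>x. u x - p (x - v)) ` S"
  \<comment> \<open>A value at v must lie above every \<open>u x - p (x - v)\<close> and below every
    \<open>p (y + v) - u y\<close>. Writing x + y as (x - v) + (y + v) shows that these constraints
    are compatible; \<alpha> is the least admissible value.\<close>
  have key: "u x - p (x - v) \<le> p (y + v) - u y" if "x \<in> S" "y \<in> S" for x y
  proof -
    have "u x + u y \<le> p (x + y)"
      using le[of "x + y"] that S by (simp add: u.add subspace_add)
    also have "\<dots> \<le> p (x - v) + p (y + v)"
      using tri[of "x - v" "y + v"] by simp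
    finally show ?thesis by simp
  qed
  have "0 \<in> S" using S by (simp add: subspace_0)
  then have "E \<noteq> {}" by (auto simp: E_def)
  have bdd: "bdd_above E"
    using key[OF _ \<open>0 \<in> S\<close>] unfolding E_def by (auto intro!: bdd_aboveI)
  define \<alpha> where "\<alpha> = Sup E"
  have lower: "u x - p (x - v) \<le> \<alpha>" if "x \<in> S" for x
    unfolding \<alpha>_def by (rule cSup_upper[OF _ bdd]) (use that in \<open>auto simp: E_def\<close>)
  have upper: "\<alpha> \<le> p (y + v) - u y" if "y \<in> S" for y
    unfolding \<alpha>_def by (rule cSup_least[OF \<open>E \<noteq> {}\<close>]) (use key[OF _ that] in \<open>auto simp: E_def\<close>)
  define u' where "u' z = u z + (\<alpha> - u v) * w z" for z
  have "linear u'"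
    unfolding u'_def
    by (rule linearI) (auto simp: u.add w.add u.scale w.scale algebra_simps)
  moreover have "u' z \<le> p z" if z: "z \<in> span (insert v S)" for z
  proof -
    obtain r where "z - r *\<^sub>R v \<in> span S"
      using z by (auto simp: span_insert)
    moreover define x where "x = z - r *\<^sub>R v"
    ultimately have xS: "x \<in> S" and zx: "z = x + r *\<^sub>R v"
      using span_eq_iff[THEN iffD2, OF S] by auto
    have u'z: "u' z = u x + r * \<alpha>"
      by (simp add: u'_def zx u.add w.add u.scale w.scale wS[OF xS] wv algebra_simps)
    \<comment> \<open>Dividing by |r| reduces domination at x + r v to r = 1 or r = -1, which are
      the upper and the lower constraint on \<alpha>.\<close>
    consider "r = 0" | "r > 0" | "r < 0" by linarith
    then show ?thesis
    proof cases
      case 1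
      then show ?thesis using u'z le[OF xS] zx by simp
    next
      case 2
      define y where "y = (1 / r) *\<^sub>R x"
      have x: "x = r *\<^sub>R y" and "y \<in> S"
        using 2 S xS by (auto simp: y_def subspace_scale)
      have "r * (u y + \<alpha>) \<le> r * p (y + v)"
        using upper[OF \<open>y \<in> S\<close>] 2 by (intro mult_left_mono) auto
      moreover have "u' z = r * (u y + \<alpha>)"
        unfolding u'z by (simp add: x u.scale algebra_simps)
      moreover have "p z = r * p (y + v)"
        using hom[OF 2, of "y + v"] by (simp add: zx x scaleR_add_right)
      ultimately show ?thesis by simp
    next
      case 3
      define y where "y = (- 1 / r) *\<^sub>R x"
      have x: "x = (- r) *\<^sub>R y" and "y \<in> S"
        using 3 subspace_scale[OF S xS, of "- 1 / r"] by (auto simp: y_def)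
      have "(- r) * (u y - \<alpha>) \<le> (- r) * p (y - v)"
        using lower[OF \<open>y \<in> S\<close>] 3 by (intro mult_left_mono) auto
      moreover have "u' z = (- r) * (u y - \<alpha>)"
        unfolding u'z unfolding x u.scale by (simp add: algebra_simps)
      moreover have "p z = (- r) * p (y - v)"
        using hom[of "- r" "y - v"] 3 by (simp add: zx x scaleR_diff_right)
      ultimately show ?thesis by simp
    qed
  qed
  ultimately show ?thesis
    using wS by (intro exI[of _ u']) (auto simp: u'_def)
qed

text \<open>Functionals are linear on the whole space and merely dominated on a subspace, which
  avoids partial functions. As only finitely many vectors are added, induction takes the place of
  Zorn's lemma.\<close>

lemma hahn_banach_finite:
  fixes p u :: "'a::real_vector \<Rightarrow> real"
  assumes tri: "\<And>x y. p (x + y) \<le> p x + p y"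
    and hom: "\<And>c x. c > 0 \<Longrightarrow> p (c *\<^sub>R x) = c * p x"
    and S: "subspace S" and u: "linear u" and le: "\<And>x. x \<in> S \<Longrightarrow> u x \<le> p x"
    and V: "finite V"
  shows "\<exists>u'. linear u' \<and> (\<forall>x\<in>S. u' x = u x) \<and> (\<forall>x\<in>span (V \<union> S). u' x \<le> p x)"
  using V
proof (induction V rule: finite_induct)
  case empty
  have "span ({} \<union> S) = S" using S by simp
  then show ?case using u le by (metis (no_types))
next
  case (insert v V)
  then obtain u1 where u1: "linear u1" "\<And>x. x \<in> S \<Longrightarrow> u1 x = u x"
      "\<And>x. x \<in> span (V \<union> S) \<Longrightarrow> u1 x \<le> p x"
    by blast
  obtain u2 where u2: "linear u2" "\<And>x. x \<in> span (V \<union> S) \<Longrightarrow> u2 x = u1 x"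
      "\<And>x. x \<in> span (insert v (span (V \<union> S))) \<Longrightarrow> u2 x \<le> p x"
    using hahn_banach_step[OF tri hom subspace_span u1(1,3), where v = v] by metis
  have "span (insert v V \<union> S) \<subseteq> span (insert v (span (V \<union> S)))"
    by (intro span_mono) (auto intro: span_base)
  then show ?case
    using u2 u1(2) by (intro exI[of _ u2]) (auto simp: span_base)
qed

lemma cesaro_mean_tendsto_0:
  fixes R :: "nat \<Rightarrow> real"
  assumes "R \<longlonglongrightarrow> 0" and nonneg: "\<And>j. R j \<ge> 0"
  shows "(\<lambda>M. (\<Sum>j\<le>M. R j) / real (M + 1)) \<longlonglongrightarrow> 0"
proof (rule LIMSEQ_I)
  fix e :: real assume e: "e > 0"
  obtain N where N: "\<And>j. j \<ge> N \<Longrightarrow> R j < e / 2"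
    using LIMSEQ_D[OF assms(1), of "e / 2"] e nonneg by auto
  define A where "A = (\<Sum>j<N. R j)"
  have "A \<ge> 0" unfolding A_def by (intro sum_nonneg nonneg)
  \<comment> \<open>Beyond K the fixed head A contributes less than e / 2 to the average; the terms
    from N on account for the other half.\<close>
  obtain K :: nat where K: "2 * A / e < real K" using reals_Archimedean2 by blast
  have "norm ((\<Sum>j\<le>M. R j) / real (M + 1) - 0) < e" if M: "M \<ge> max K N" for M
  proof -
    have "(\<Sum>j\<le>M. R j) \<le> (\<Sum>j\<le>M. (if j < N then R j else 0) + e / 2)"
      using N nonneg e by (intro sum_mono) (auto simp: not_less less_imp_le)
    also have "\<dots> = (\<Sum>j\<le>M. if j < N then R j else 0) + real (M + 1) * (e / 2)"
      by (simp add: sum.distrib)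
    also have "(\<Sum>j\<le>M. if j < N then R j else 0) = A"
      unfolding A_def by (rule sum.mono_neutral_cong_right) (use M in auto)
    also have "A < real (M + 1) * (e / 2)"
      using K M e by (simp add: field_simps) (smt (verit) max.bounded_iff mult_left_mono of_nat_mono)
    finally have "(\<Sum>j\<le>M. R j) < real (M + 1) * e" by (simp add: algebra_simps)
    moreover have "(\<Sum>j\<le>M. R j) \<ge> 0" by (intro sum_nonneg nonneg)
    ultimately show ?thesis by (simp add: field_simps)
  qed
  then show "\<exists>no. \<forall>M\<ge>no. norm ((\<Sum>j\<le>M. R j) / real (M + 1) - 0) < e" by blast
qed

text \<open>Sokal's proof: for a seminorm and any centre x, one of the points x + u, x - u has seminorm
  at least that of u, so a sequence of steps of size 3^-j can be steered to make the functionals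
  blow up in the limit. Spaces are given as sets of functions with a seminorm, so that it applies
  to L1 without passing to classes.\<close>
lemma uniform_boundedness:
  fixes X :: "('x \<Rightarrow> complex) set" and N :: "('x \<Rightarrow> complex) \<Rightarrow> real"
    and \<phi> :: "'i \<Rightarrow> ('x \<Rightarrow> complex) \<Rightarrow> complex"
  assumes zero: "(\<lambda>t. 0) \<in> X"
    and comb: "\<And>c x y. x \<in> X \<Longrightarrow> y \<in> X \<Longrightarrow> (\<lambda>t. x t + c * y t) \<in> X"
    and N0: "\<And>x. x \<in> X \<Longrightarrow> N x \<ge> 0"
    and Nc: "\<And>c x. x \<in> X \<Longrightarrow> N (\<lambda>t. c * x t) = norm c * N x"
    and Nt: "\<And>x y. x \<in> X \<Longrightarrow> y \<in> X \<Longrightarrow> N (\<lambda>t. x t + y t) \<le> N x + N y"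
    and complete: "\<And>s. (\<And>j. s j \<in> X) \<Longrightarrow> (\<And>j. N (\<lambda>t. s (Suc j) t - s j t) \<le> (1/3) ^ j)
        \<Longrightarrow> \<exists>x\<in>X. (\<lambda>j. N (\<lambda>t. x t - s j t)) \<longlonglongrightarrow> 0"
    and lin: "\<And>i c x y. x \<in> X \<Longrightarrow> y \<in> X \<Longrightarrow> \<phi> i (\<lambda>t. x t + c * y t) = \<phi> i x + c * \<phi> i y"
    and bdd: "\<And>i. \<exists>K. \<forall>x\<in>X. norm (\<phi> i x) \<le> K * N x"
    and ptw: "\<And>x. x \<in> X \<Longrightarrow> \<exists>B. \<forall>i. norm (\<phi> i x) \<le> B"
  shows "\<exists>C. \<forall>i. \<forall>x\<in>X. norm (\<phi> i x) \<le> C * N x"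
proof (rule ccontr)
  assume "\<not> ?thesis"
  then have unb: "\<And>C. \<exists>i. \<exists>x\<in>X. norm (\<phi> i x) > C * N x" by (auto simp: not_le)
  have scale: "(\<lambda>t. c * x t) \<in> X" if "x \<in> X" for c x using comb[OF zero that, of c] by simp
  have phi0: "\<phi> i (\<lambda>t. 0) = 0" for i using lin[OF zero zero, of i 1] by simp
  have phic: "\<phi> i (\<lambda>t. c * x t) = c * \<phi> i x" if "x \<in> X" for i c x
    using lin[OF zero that, of i c] by (simp add: phi0)
  have diff: "(\<lambda>t. x t - y t) \<in> X" if "x \<in> X" "y \<in> X" for x y
    using comb[OF that, of "-1"] by simp
  \<comment> \<open>\<kappa> will be the operator norm of a functional chosen so that this norm is
    at least 4^j, and w nearly attains it on the unit ball. The factor 3/4 has to exceed 1/2, the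
    share that the later steps can cancel.\<close>
  have "\<exists>i \<kappa> w. w \<in> X \<and> N w \<le> 1 \<and> \<kappa> \<ge> 4 ^ j \<and> norm (\<phi> i w) \<ge> 3 / 4 * \<kappa> \<and> (\<forall>x\<in>X. norm (\<phi> i x) \<le> \<kappa> * N x)"
    for j :: nat
  proof -
    obtain i x where i: "x \<in> X" "norm (\<phi> i x) > 4 ^ j * N x" using unb by blast
    obtain K where K: "\<And>x. x \<in> X \<Longrightarrow> norm (\<phi> i x) \<le> K * N x" using bdd by blast
    define E where "E = (\<lambda>x. norm (\<phi> i x)) ` {x\<in>X. N x \<le> 1}"
    have "K' \<le> max K 0" if "K' \<in> E" for K'
    proof -
      obtain y where y: "y \<in> X" "N y \<le> 1" "K' = norm (\<phi> i y)" using \<open>K' \<in> E\<close> unfolding E_def by blast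
      have "K' \<le> max K 0 * N y" using K[OF y(1)] y(3) N0[OF y(1)]
        by (smt (verit) mult_right_mono)
      also have "\<dots> \<le> max K 0" using y(2) N0[OF y(1)] by (simp add: mult_left_le)
      finally show ?thesis .
    qed
    then have bE: "bdd_above E" by (rule bdd_aboveI)
    have N00: "N (\<lambda>t. 0) = 0" using Nc[OF zero, of 0] by simp
    then have "E \<noteq> {}" using zero by (auto simp: E_def intro!: exI[of _ "\<lambda>t. 0"])
    define \<kappa> where "\<kappa> = Sup E"
    have le: "norm (\<phi> i y) \<le> \<kappa> * N y" if "y \<in> X" for y
    \<comment> \<open>N is only a seminorm and may vanish at y; the individual bound K then makes
      the functional vanish there as well.\<close>
    proof (cases "N y = 0")
      case True then show ?thesis using K[OF that] by simp
    next
      case False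
      then have pos: "N y > 0" using N0[OF that] by simp
      define z where "z = (\<lambda>t. complex_of_real (1 / N y) * y t)"
      have "z \<in> X" unfolding z_def by (rule scale[OF that])
      moreover have "N z = 1" unfolding z_def by (subst Nc[OF that]) (use pos in \<open>simp add: norm_divide\<close>)
      ultimately have "norm (\<phi> i z) \<le> \<kappa>"
        unfolding \<kappa>_def by (intro cSup_upper[OF _ bE]) (auto simp: E_def)
      moreover have "\<phi> i z = complex_of_real (1 / N y) * \<phi> i y"
        unfolding z_def by (rule phic[OF that])
      ultimately show ?thesis using pos by (simp add: norm_mult norm_divide field_simps)
    qed
    have "N x > 0" using i K[OF i(1)] N0[OF i(1)] by (cases "N x = 0") auto
    then have k4: "\<kappa> > 4 ^ j" using i(2) le[OF i(1)] by (meson less_le_trans mult_less_cancel_right_pos)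
    then have "\<kappa> > 0" by (smt (verit) zero_less_power)
    then have "3 / 4 * \<kappa> < Sup E" by (simp add: \<kappa>_def)
    then obtain e where "e \<in> E" "3 / 4 * \<kappa> < e" using less_cSup_iff[OF \<open>E \<noteq> {}\<close> bE] by blast
    then obtain w where "w \<in> X" "N w \<le> 1" "3 / 4 * \<kappa> < norm (\<phi> i w)" by (auto simp: E_def)
    then show ?thesis using le k4 by (intro exI[of _ i] exI[of _ \<kappa>] exI[of _ w]) auto
  qed
  then obtain i \<kappa> w where W: "\<And>j. w j \<in> X" "\<And>j. N (w j) \<le> 1" "\<And>j::nat. \<kappa> j \<ge> 4 ^ j"
      "\<And>j. norm (\<phi> (i j) (w j)) \<ge> 3 / 4 * \<kappa> j"
      "\<And>j x. x \<in> X \<Longrightarrow> norm (\<phi> (i j) x) \<le> \<kappa> j * N x"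
    by metis
  define r :: "nat \<Rightarrow> complex" where "r j = (1/3) ^ j" for j
  define step where "step j x = (\<lambda>t. x t + (if norm (\<phi> (i j) (\<lambda>t. x t + r j * w j t)) \<ge> norm (\<phi> (i j) (\<lambda>t. x t + (- r j) * w j t))
      then r j else - r j) * w j t)" for j x
  define s where "s = rec_nat (\<lambda>t. 0) step"
  have s_Suc: "s (Suc j) = step j (s j)" for j by (simp add: s_def)
  have sX: "s j \<in> X" for j
  proof (induction j)
    case 0 then show ?case using zero by (simp add: s_def)
  next
    case (Suc j) then show ?case unfolding s_Suc step_def by (intro comb W)
  qed
  have rn: "norm (r j) = (1/3) ^ j" for j by (simp add: r_def norm_power norm_divide)
  have step_N: "N (\<lambda>t. s (Suc j) t - s j t) \<le> (1/3) ^ j" for j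
  proof -
    define c where "c = (if norm (\<phi> (i j) (\<lambda>t. s j t + r j * w j t)) \<ge> norm (\<phi> (i j) (\<lambda>t. s j t + (- r j) * w j t))
      then r j else - r j)"
    have c: "norm c = (1/3) ^ j" "(\<lambda>t. s (Suc j) t - s j t) = (\<lambda>t. c * w j t)"
      using rn[of j] unfolding s_Suc step_def c_def by auto
    show ?thesis unfolding c(2) Nc[OF W(1)] c(1) using W(2)[of j] by (simp add: mult_left_le)
  qed
  have step_phi: "norm (\<phi> (i j) (s (Suc j))) \<ge> (1/3) ^ j * (3 / 4 * \<kappa> j)" for j
  proof -
    let ?p = "\<phi> (i j) (\<lambda>t. s j t + r j * w j t)" and ?m = "\<phi> (i j) (\<lambda>t. s j t + (- r j) * w j t)"
    have "?p - ?m = 2 * (r j * \<phi> (i j) (w j))" by (simp only: lin[OF sX W(1)]) simp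
    then have "2 * ((1/3) ^ j * norm (\<phi> (i j) (w j))) = norm (?p - ?m)"
      by (simp add: norm_mult rn)
    also have "\<dots> \<le> norm ?p + norm ?m" by (rule norm_triangle_ineq4)
    also have "\<dots> \<le> 2 * norm (\<phi> (i j) (s (Suc j)))"
      unfolding s_Suc step_def by auto
    finally have "(1/3) ^ j * norm (\<phi> (i j) (w j)) \<le> norm (\<phi> (i j) (s (Suc j)))" by simp
    moreover have "(1/3) ^ j * (3 / 4 * \<kappa> j) \<le> (1/3) ^ j * norm (\<phi> (i j) (w j))"
      by (intro mult_left_mono W(4)) simp
    ultimately show ?thesis by linarith
  qed
  obtain x where x: "x \<in> X" and lim: "(\<lambda>j. N (\<lambda>t. x t - s j t)) \<longlonglongrightarrow> 0"
    using complete[of s] sX step_N by blast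
  have tri: "N (\<lambda>t. x t - z t) \<le> N (\<lambda>t. x t - y t) + N (\<lambda>t. y t - z t)" if "x \<in> X" "y \<in> X" "z \<in> X" for x y z
    using Nt[OF diff[OF that(1,2)] diff[OF that(2,3)]] by simp
  \<comment> \<open>The steps from j to j + m - 1 have total length at most the geometric sum (3/2)
    (1/3)^j (1 - (1/3)^m).\<close>
  have tele: "N (\<lambda>t. x t - s j t) \<le> N (\<lambda>t. x t - s (j + m) t) + (3/2) * (1/3) ^ j * (1 - (1/3) ^ m)" for j m
  proof (induction m)
    case (Suc m)
    have "N (\<lambda>t. x t - s (j + m) t) \<le> N (\<lambda>t. x t - s (Suc (j + m)) t) + (1/3) ^ (j + m)"
      using tri[OF x sX[of "Suc (j + m)"] sX[of "j + m"]] step_N[of "j + m"] by linarith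
    moreover have "P \<le> R + (3/2) * A * (1 - (1/3) * B)"
      if "P \<le> Q + (3/2) * A * (1 - B)" "Q \<le> R + A * B" for P Q R A B :: real
      using that by (simp add: field_simps)
    ultimately show ?case using Suc unfolding power_add power_Suc add_Suc_right by blast
  qed simp
  have dist: "N (\<lambda>t. x t - s j t) \<le> (3/2) * (1/3) ^ j" for j
  proof (rule LIMSEQ_le_const)
    show "(\<lambda>m. N (\<lambda>t. x t - s (m + j) t) + (3/2) * (1/3) ^ j) \<longlonglongrightarrow> (3/2) * (1/3) ^ j"
      using tendsto_add[OF LIMSEQ_ignore_initial_segment[OF lim, of j] tendsto_const, of "(3/2) * (1/3) ^ j"] by simp
    have "N (\<lambda>t. x t - s j t) \<le> N (\<lambda>t. x t - s (m + j) t) + (3/2) * (1/3) ^ j" for m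
    proof -
      have "(3/2) * (1/3) ^ j * (1 - (1/3) ^ m) \<le> (3/2) * (1/3) ^ j * (1 :: real)"
        by (intro mult_left_mono) auto
      then show ?thesis using tele[of j m] unfolding add.commute[of m j] by linarith
    qed
    then show "\<exists>M. \<forall>n\<ge>M. N (\<lambda>t. x t - s j t) \<le> N (\<lambda>t. x t - s (n + j) t) + (3/2) * (1/3) ^ j" by blast
  qed
  \<comment> \<open>The limit is within (3/2) (1/3)^(j+1) of \<open>s (Suc j)\<close>, so at least
    (3/4 - 1/2) (1/3)^j \<kappa> survives; with \<kappa> \<ge> 4^j this is (1/4) (4/3)^j, which is
    unbounded.\<close>
  have big: "norm (\<phi> (i j) x) \<ge> (1/4) * (4/3) ^ j" for j
  proof -
    have e: "\<phi> (i j) x = \<phi> (i j) (s (Suc j)) + \<phi> (i j) (\<lambda>t. x t - s (Suc j) t)"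
      using lin[OF sX diff[OF x sX], of "i j" "Suc j" 1 "Suc j"] by simp
    have "norm (\<phi> (i j) (\<lambda>t. x t - s (Suc j) t)) \<le> \<kappa> j * N (\<lambda>t. x t - s (Suc j) t)"
      by (rule W(5)[OF diff[OF x sX]])
    also have "\<dots> \<le> \<kappa> j * ((3/2) * (1/3) ^ Suc j)"
      by (rule mult_left_mono[OF dist]) (smt (verit) W(3)[of j] zero_le_power)
    finally have "norm (\<phi> (i j) (\<lambda>t. x t - s (Suc j) t)) \<le> (1/3) ^ j * (1/2 * \<kappa> j)"
      by (simp add: algebra_simps)
    moreover have "norm (\<phi> (i j) (s (Suc j))) \<le> norm (\<phi> (i j) x) + norm (\<phi> (i j) (\<lambda>t. x t - s (Suc j) t))"
      using norm_triangle_ineq4[of "\<phi> (i j) x" "\<phi> (i j) (\<lambda>t. x t - s (Suc j) t)"] by (simp add: e)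
    ultimately have "(1/3) ^ j * (1/4 * \<kappa> j) \<le> norm (\<phi> (i j) x)"
      using step_phi[of j] by (simp add: algebra_simps)
    moreover have "(1/3) ^ j * (1/4 * 4 ^ j) \<le> (1/3) ^ j * (1/4 * \<kappa> j)"
      by (intro mult_left_mono W(3)) auto
    moreover have "(1/3) ^ j * (1/4 * 4 ^ j) = (1/4) * (4/3 :: real) ^ j"
      by (simp add: power_divide)
    ultimately show ?thesis by linarith
  qed
  obtain B where B: "\<And>i. norm (\<phi> i x) \<le> B" using ptw[OF x] by blast
  obtain j where "4 * B < (4/3) ^ j" using real_arch_pow[of "4/3" "4 * B"] by auto
  then show False using big[of j] B[of "i j"] by simp
qed

section \<open>The disk algebra and its pairing with L1\<close>

abbreviation Leb :: "real measure" where "Leb \<equiv> lebesgue_on {0..2*pi}"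

lemma finite_measure_Leb: "finite_measure Leb"
  by (rule finite_measure_lebesgue_on) simp

lemma measure_space_Leb: "measure Leb {0..2*pi} = 2*pi"
  by (simp add: measure_restrict_space)

lemma borel_measurable_Leb_continuous:
  "continuous_on {0..2*pi} f \<Longrightarrow> f \<in> borel_measurable Leb"
  by (rule continuous_imp_measurable_on_sets_lebesgue) auto

lemma integrable_bounded_mult:
  fixes \<phi> g :: "'a \<Rightarrow> complex"
  assumes g: "integrable M g" and \<phi>: "\<phi> \<in> borel_measurable M"
    and B: "\<And>t. t \<in> space M \<Longrightarrow> norm (\<phi> t) \<le> B"
  shows "integrable M (\<lambda>t. \<phi> t * g t)"
proof (rule Bochner_Integration.integrable_bound)
  show "integrable M (\<lambda>t. B * norm (g t))" using g by simp
  show "(\<lambda>t. \<phi> t * g t) \<in> borel_measurable M" using g \<phi> by measurable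
  show "AE t in M. norm (\<phi> t * g t) \<le> norm (B * norm (g t))"
  proof (rule AE_I2)
    fix t assume "t \<in> space M"
    then have "norm (\<phi> t) \<le> \<bar>B\<bar>" using B by force
    then show "norm (\<phi> t * g t) \<le> norm (B * norm (g t))"
      by (simp add: norm_mult abs_mult mult_right_mono)
  qed
qed

lemma norm_integral_bounded_mult:
  fixes \<phi> g :: "'a \<Rightarrow> complex"
  assumes g: "integrable M g" and \<phi>: "\<phi> \<in> borel_measurable M"
    and B: "\<And>t. t \<in> space M \<Longrightarrow> norm (\<phi> t) \<le> B"
  shows "norm (\<integral>t. \<phi> t * g t \<partial>M) \<le> B * (\<integral>t. norm (g t) \<partial>M)"
proof -
  have "norm (\<integral>t. \<phi> t * g t \<partial>M) \<le> (\<integral>t. norm (\<phi> t * g t) \<partial>M)"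
    by simp
  also have "\<dots> \<le> (\<integral>t. B * norm (g t) \<partial>M)"
    using g B by (intro integral_mono Bochner_Integration.integrable_norm integrable_bounded_mult[OF assms])
      (auto simp: norm_mult intro: mult_right_mono)
  finally show ?thesis by simp
qed

text \<open>Every pairing with a series is computed through this interchange, by domination with the
  sum of |c k| times |w|. The measure is arbitrary because it serves Lebesgue measure as well as
  measures on the circle.\<close>

lemma integral_suminf_bounded_mult:
  fixes \<phi> :: "nat \<Rightarrow> 'a \<Rightarrow> complex" and w :: "'a \<Rightarrow> complex"
  assumes w: "integrable M w" and \<phi>: "\<And>k. \<phi> k \<in> borel_measurable M"
    and le: "\<And>k t. t \<in> space M \<Longrightarrow> norm (\<phi> k t) \<le> 1" and c: "summable (\<lambda>k. norm (c k))"
  shows "(\<integral>t. (\<Sum>k. c k * \<phi> k t) * w t \<partial>M) = (\<Sum>k. c k * (\<integral>t. \<phi> k t * w t \<partial>M))"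
proof -
  have int: "integrable M (\<lambda>t. \<phi> k t * w t)" for k
    by (rule integrable_bounded_mult[OF w \<phi> le])
  have pt: "summable (\<lambda>k. norm (c k * \<phi> k t))" if "t \<in> space M" for t
    by (rule summable_comparison_test'[OF c, of 0]) (use le[OF that] in \<open>auto simp: norm_mult mult_left_le\<close>)
  have "(\<integral>t. (\<Sum>k. c k * \<phi> k t) * w t \<partial>M) = (\<integral>t. (\<Sum>k. c k * (\<phi> k t * w t)) \<partial>M)"
    by (intro Bochner_Integration.integral_cong refl)
      (use suminf_mult2[OF summable_norm_cancel[OF pt]] in \<open>simp add: mult.assoc\<close>)
  also have "\<dots> = (\<Sum>k. \<integral>t. c k * (\<phi> k t * w t) \<partial>M)"
  proof (rule integral_suminf)
    show "integrable M (\<lambda>t. c k * (\<phi> k t * w t))" for k using int by simp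
    show "AE t in M. summable (\<lambda>k. norm (c k * (\<phi> k t * w t)))"
      by (rule AE_I2) (use summable_mult2[OF pt] in \<open>simp add: norm_mult mult.assoc\<close>)
    show "summable (\<lambda>k. \<integral>t. norm (c k * (\<phi> k t * w t)) \<partial>M)"
    proof (rule summable_comparison_test'[OF summable_mult2[OF c, of "\<integral>t. norm (w t) \<partial>M"], of 0])
      fix k :: nat
      have "(\<integral>t. norm (\<phi> k t * w t) \<partial>M) \<le> (\<integral>t. norm (w t) \<partial>M)"
        using le by (intro integral_mono Bochner_Integration.integrable_norm int w)
          (simp add: norm_mult mult_left_le_one_le)
      then show "norm (\<integral>t. norm (c k * (\<phi> k t * w t)) \<partial>M) \<le> norm (c k) * (\<integral>t. norm (w t) \<partial>M)"
        by (simp add: norm_mult[of "c k"] mult_left_mono)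
    qed
  qed
  also have "\<dots> = (\<Sum>k. c k * (\<integral>t. \<phi> k t * w t \<partial>M))" by simp
  finally show ?thesis .
qed

lemma integral_cis:
  "(\<integral>t. cis (of_int m * t) \<partial>Leb) = (if m = 0 then of_real (2*pi) else 0)"
proof -
  have int: "integrable Leb (\<lambda>t. cis (of_int m * t))"
    by (intro continuous_imp_integrable_real continuous_intros)
  have "(\<integral>t. cis (of_int m * t) \<partial>Leb) = integral {0..2*pi} (\<lambda>t. cis (of_int m * t))"
    by (rule lebesgue_integral_eq_integral[OF int]) auto
  also have "\<dots> = (if m = 0 then of_real (2*pi) else 0)"
  proof (cases "m = 0")
    case True then show ?thesis by (simp add: scaleR_conv_of_real)
  next
    case False
    have "((\<lambda>t. cis (of_int m * t)) has_integral
        (cis (of_int m * (2*pi)) / (\<i> * of_int m) - cis (of_int m * 0) / (\<i> * of_int m))) {0..2*pi}"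
      using False
      by (intro fundamental_theorem_of_calculus)
        (auto simp: has_vector_derivative_def scaleR_conv_of_real field_simps intro!: derivative_eq_intros)
    moreover have "cis (of_int m * (2*pi)) = 1"
      using cis_multiple_2pi[of "of_int m"] by (simp add: mult.commute)
    ultimately show ?thesis using False by (simp add: integral_unique)
  qed
  finally show ?thesis .
qed

section \<open>The disk algebra, its sup-norm, and the pairing with L1\<close>

lemma disk_algebra_comb:
  "f \<in> disk_algebra \<Longrightarrow> g \<in> disk_algebra \<Longrightarrow> (\<lambda>z. f z + c * g z) \<in> disk_algebra"
  by (auto simp: disk_algebra_def intro!: holomorphic_intros continuous_intros)

lemma disk_algebra_diff:
  "f \<in> disk_algebra \<Longrightarrow> g \<in> disk_algebra \<Longrightarrow> (\<lambda>z. f z - g z) \<in> disk_algebra"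
  using disk_algebra_comb[of f g "- 1"] by simp

lemma disk_algebra_const: "(\<lambda>z. c) \<in> disk_algebra"
  by (auto simp: disk_algebra_def)

lemma disk_algebra_cmult: "f \<in> disk_algebra \<Longrightarrow> (\<lambda>z. c * f z) \<in> disk_algebra"
  using disk_algebra_comb[OF disk_algebra_const[of 0], of f c] by simp

lemma disk_algebra_power: "(\<lambda>z. z ^ k) \<in> disk_algebra"
  by (auto simp: disk_algebra_def intro!: holomorphic_intros continuous_intros)

lemma bdd_above_disk_algebra:
  assumes "f \<in> disk_algebra"
  shows "bdd_above ((\<lambda>z. norm (f z)) ` cball 0 1)"
  by (intro bounded_imp_bdd_above compact_imp_bounded compact_continuous_image)
    (use assms in \<open>auto simp: disk_algebra_def intro!: continuous_intros\<close>)

lemma norm_le_sup_norm: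
  "f \<in> disk_algebra \<Longrightarrow> z \<in> cball 0 1 \<Longrightarrow> norm (f z) \<le> sup_norm f"
  unfolding sup_norm_def
  using cSUP_upper[of z "cball 0 1" "\<lambda>z. norm (f z)"] bdd_above_disk_algebra[of f] by simp

lemma sup_norm_least:
  assumes "\<And>z. z \<in> cball 0 1 \<Longrightarrow> norm (f z) \<le> B"
  shows "sup_norm f \<le> B"
proof -
  have "cball (0::complex) 1 \<noteq> {}" by simp
  then show ?thesis
    unfolding sup_norm_def using assms by (rule cSUP_least)
qed

lemma sup_norm_nonneg: "f \<in> disk_algebra \<Longrightarrow> sup_norm f \<ge> 0"
  by (rule order_trans[OF norm_ge_zero norm_le_sup_norm[of f 0]]) auto

lemma sup_norm_cmult:
  assumes "f \<in> disk_algebra"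
  shows "sup_norm (\<lambda>z. c * f z) = norm c * sup_norm f"
proof (rule antisym)
  show "sup_norm (\<lambda>z. c * f z) \<le> norm c * sup_norm f"
    by (rule sup_norm_least) (simp add: norm_mult mult_left_mono norm_le_sup_norm[OF assms])
  show "norm c * sup_norm f \<le> sup_norm (\<lambda>z. c * f z)"
  proof (cases "c = 0")
    case True then show ?thesis using sup_norm_nonneg[OF disk_algebra_cmult[OF assms, of c]] by simp
  next
    case False
    have "sup_norm f \<le> sup_norm (\<lambda>z. c * f z) / norm c"
      using norm_le_sup_norm[OF disk_algebra_cmult[OF assms, of c]] False
      by (intro sup_norm_least) (simp add: norm_mult field_simps)
    then show ?thesis using False by (simp add: field_simps)
  qed
qed

lemma sup_norm_triangle:
  assumes "f \<in> disk_algebra" "g \<in> disk_algebra"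
  shows "sup_norm (\<lambda>z. f z + g z) \<le> sup_norm f + sup_norm g"
  by (rule sup_norm_least) (meson add_mono assms norm_le_sup_norm norm_triangle_le)

lemma borel_measurable_disk_algebra_cis:
  assumes "f \<in> disk_algebra"
  shows "(\<lambda>t. f (cis (- t))) \<in> borel_measurable Leb"
  by (rule borel_measurable_Leb_continuous, rule continuous_on_compose2[of "cball 0 1" f])
    (use assms in \<open>auto simp: disk_algebra_def intro!: continuous_intros\<close>)

lemma integrable_L1_pair:
  assumes f: "f \<in> disk_algebra" and g: "L1T g"
  shows "integrable Leb (\<lambda>t. f (cis (- t)) * g t)"
  by (rule integrable_bounded_mult[of _ _ _ "sup_norm f"])
    (use g in \<open>auto simp: L1T_def intro!: borel_measurable_disk_algebra_cis[OF f] norm_le_sup_norm[OF f]\<close>)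

lemma L1_pair_comb_left:
  assumes "f \<in> disk_algebra" "f' \<in> disk_algebra" "L1T g"
  shows "L1_pair (\<lambda>z. f z + c * f' z) g = L1_pair f g + c * L1_pair f' g"
  using integrable_L1_pair[OF assms(1,3)] integrable_L1_pair[OF assms(2,3)]
  by (simp add: L1_pair_def distrib_right add_divide_distrib mult.assoc)

lemma L1T_comb: "L1T g \<Longrightarrow> L1T h \<Longrightarrow> L1T (\<lambda>t. g t + c * h t)"
  by (simp add: L1T_def)

lemma L1T_diff: "L1T g \<Longrightarrow> L1T h \<Longrightarrow> L1T (\<lambda>t. g t - h t)"
  by (simp add: L1T_def)

lemma L1T_continuous: "continuous_on {0..2*pi} g \<Longrightarrow> L1T g"
  unfolding L1T_def by (rule continuous_imp_integrable_real)

lemma L1T_cis: "L1T (\<lambda>t. cis (of_int m * t))" "L1T (\<lambda>t. cis (real k * t))"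
  by (auto intro!: L1T_continuous continuous_intros)

lemma L1_pair_comb_right:
  assumes "f \<in> disk_algebra" "L1T g" "L1T h"
  shows "L1_pair f (\<lambda>t. g t + c * h t) = L1_pair f g + c * L1_pair f h"
  using integrable_L1_pair[OF assms(1,2)] integrable_L1_pair[OF assms(1,3)]
  by (simp add: L1_pair_def distrib_left add_divide_distrib mult.left_commute)

text \<open>As pairings with monomials, Fourier coefficients inherit linearity and bounds from
  \<open>L1_pair\<close>.\<close>

lemma L1_coeff_eq_pair: "L1_coeff g k = L1_pair (\<lambda>z. z ^ k) g"
  by (simp add: L1_coeff_def L1_pair_def Complex.DeMoivre mult.commute)

lemma L1_coeff_comb:
  "L1T g \<Longrightarrow> L1T h \<Longrightarrow> L1_coeff (\<lambda>t. g t + c * h t) k = L1_coeff g k + c * L1_coeff h k"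
  unfolding L1_coeff_eq_pair by (rule L1_pair_comb_right[OF disk_algebra_power])

lemma L1_coeff_cis: "L1_coeff (\<lambda>t. cis (of_int m * t)) k = (if m = int k then 1 else 0)"
proof -
  have "(\<lambda>t. cis (of_int m * t) * cis (- (real k * t))) = (\<lambda>t. cis (of_int (m - int k) * t))"
    by (auto simp: cis_mult algebra_simps)
  then show ?thesis unfolding L1_coeff_def using integral_cis[of "m - int k"] by simp
qed

lemma norm_L1_pair_le:
  assumes f: "f \<in> disk_algebra" and g: "L1T g" and B: "\<And>z. norm z = 1 \<Longrightarrow> norm (f z) \<le> B"
  shows "norm (L1_pair f g) \<le> B * L1_norm g"
proof -
  have "norm (\<integral>t. f (cis (- t)) * g t \<partial>Leb) \<le> B * (\<integral>t. norm (g t) \<partial>Leb)"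
    by (rule norm_integral_bounded_mult)
      (use g B in \<open>auto simp: L1T_def intro!: borel_measurable_disk_algebra_cis[OF f]\<close>)
  then show ?thesis
    by (simp add: L1_pair_def L1_norm_def norm_divide norm_mult field_simps)
qed

lemma norm_L1_pair_le_sup_norm:
  assumes f: "f \<in> disk_algebra" and g: "L1T g"
  shows "norm (L1_pair f g) \<le> sup_norm f * L1_norm g"
  by (rule norm_L1_pair_le[OF f g]) (auto intro: norm_le_sup_norm[OF f])

lemma L1_norm_nonneg: "L1_norm g \<ge> 0"
  by (simp add: L1_norm_def)

lemma norm_L1_coeff_le: "L1T g \<Longrightarrow> norm (L1_coeff g k) \<le> L1_norm g"
  unfolding L1_coeff_eq_pair
  using norm_L1_pair_le[OF disk_algebra_power, of g k 1] by (simp add: norm_power)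

text \<open>Cauchy's formula on the unit circle itself, available because f is continuous up to the
  boundary. It is the source of the linearity of Taylor coefficients and of their bound by the
  sup-norm.\<close>

lemma taylor_coeff_eq_pair:
  assumes f: "f \<in> disk_algebra"
  shows "taylor_coeff f k = L1_pair f (\<lambda>t. cis (real k * t))"
proof -
  have "((\<lambda>u. f u / (u - 0) ^ Suc k) has_contour_integral
      2 * pi * \<i> / fact k * (deriv ^^ k) f 0) (circlepath 0 1)"
    by (rule Cauchy_has_contour_integral_higher_derivative_circlepath)
      (use f in \<open>auto simp: disk_algebra_def\<close>)
  \<comment> \<open>\<open>L1_pair\<close> evaluates f at cis (-t), so the circle is parametrised
    over [-2 pi, 0] and the integral is then reflected.\<close>
  moreover have "circlepath 0 1 = part_circlepath 0 1 (- (2*pi)) 0"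
  proof
    fix x
    have "2 * of_real pi * \<i> * of_real x
        = \<i> * linepath (of_real (- (2*pi))) (of_real 0) x + 2 * of_real pi * \<i>"
      by (simp add: linepath_def scaleR_conv_of_real algebra_simps)
    then have "exp (2 * of_real pi * \<i> * of_real x) = exp (\<i> * linepath (of_real (- (2*pi))) (of_real 0) x)"
      by (simp only: exp_add exp_two_pi_i) simp
    then show "circlepath 0 1 x = part_circlepath 0 1 (- (2*pi)) 0 x"
      by (simp add: circlepath part_circlepath_def of_real_linepath)
  qed
  ultimately have "((\<lambda>t. f (cis t) / cis t ^ Suc k * \<i> * cis t) has_integral
      2 * pi * \<i> / fact k * (deriv ^^ k) f 0) {- (2*pi)..0}"
    using has_contour_integral_part_circlepath_iff[of "- (2*pi)" 0 _ _ 0 1] by simp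
  then have "((\<lambda>t. f (cis (- t)) / cis (- t) ^ Suc k * \<i> * cis (- t)) has_integral
      2 * pi * \<i> / fact k * (deriv ^^ k) f 0) {- 0..- (- (2*pi))}"
    by (rule has_integral_reflect_lemma_real)
  moreover have "f (cis (- t)) / cis (- t) ^ Suc k * \<i> * cis (- t) = \<i> * (f (cis (- t)) * cis (real k * t))" for t
  proof -
    have "cis (- t) ^ Suc k = cis (- t) * inverse (cis (real k * t))"
      by (simp add: Complex.DeMoivre)
    then show ?thesis by (simp add: field_simps)
  qed
  ultimately have "((\<lambda>t. \<i> * (f (cis (- t)) * cis (real k * t))) has_integral
      2 * pi * \<i> / fact k * (deriv ^^ k) f 0) {0..2*pi}" by simp
  moreover have "((\<lambda>t. \<i> * (f (cis (- t)) * cis (real k * t))) has_integral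
      (\<integral>t. \<i> * (f (cis (- t)) * cis (real k * t)) \<partial>Leb)) {0..2*pi}"
    using integrable_L1_pair[OF f L1T_cis(2)] by (intro has_integral_integral_lebesgue_on) auto
  ultimately have "2 * pi * \<i> / fact k * (deriv ^^ k) f 0 = (\<integral>t. \<i> * (f (cis (- t)) * cis (real k * t)) \<partial>Leb)"
    by (rule has_integral_unique)
  then show ?thesis by (simp add: taylor_coeff_def L1_pair_def field_simps)
qed

lemma taylor_coeff_comb:
  "f \<in> disk_algebra \<Longrightarrow> g \<in> disk_algebra \<Longrightarrow>
    taylor_coeff (\<lambda>z. f z + c * g z) k = taylor_coeff f k + c * taylor_coeff g k"
  by (simp add: taylor_coeff_eq_pair disk_algebra_comb L1_pair_comb_left L1T_cis)

lemma norm_taylor_coeff_le: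
  assumes "f \<in> disk_algebra"
  shows "norm (taylor_coeff f k) \<le> sup_norm f"
  unfolding taylor_coeff_eq_pair[OF assms]
  using norm_L1_pair_le_sup_norm[OF assms L1T_cis(2), of k] by (simp add: L1_norm_def measure_space_Leb)

section \<open>Absolutely convergent power series and density of polynomials\<close>

lemma summable_power_series:
  fixes c :: "nat \<Rightarrow> complex"
  assumes "summable (\<lambda>k. norm (c k))" "norm z \<le> 1"
  shows "summable (\<lambda>k. norm (c k * z ^ k))"
  by (rule summable_comparison_test'[OF assms(1), of 0])
    (use assms(2) in \<open>auto simp: norm_mult norm_power mult_left_le power_le_one\<close>)

lemma uniform_limit_power_series:
  fixes c :: "nat \<Rightarrow> complex"
  assumes "summable (\<lambda>k. norm (c k))"
  shows "uniform_limit (cball 0 1) (\<lambda>n z. \<Sum>k<n. c k * z ^ k) (\<lambda>z. \<Sum>k. c k * z ^ k) sequentially"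
  by (rule Weierstrass_m_test[OF _ assms])
    (auto simp: norm_mult norm_power mult_left_le power_le_one)

lemma power_series_disk_algebra:
  fixes c :: "nat \<Rightarrow> complex"
  assumes "summable (\<lambda>k. norm (c k))"
  shows "(\<lambda>z. \<Sum>k. c k * z ^ k) \<in> disk_algebra"
  unfolding disk_algebra_def
proof (intro CollectI conjI)
  show "(\<lambda>z. \<Sum>k. c k * z ^ k) holomorphic_on ball 0 1"
    by (rule power_series_holomorphic[of _ _ c])
      (use summable_sums[OF summable_norm_cancel[OF summable_power_series[OF assms]]] in auto)
  show "continuous_on (cball 0 1) (\<lambda>z. \<Sum>k. c k * z ^ k)"
    by (rule uniform_limit_theorem[OF _ uniform_limit_power_series[OF assms]])
      (auto intro!: always_eventually continuous_intros)
qed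

lemma L1_pair_power_series:
  assumes c: "summable (\<lambda>k. norm (c k))" and g: "L1T g"
  shows "L1_pair (\<lambda>z. \<Sum>k. c k * z ^ k) g = (\<Sum>k. c k * L1_coeff g k)"
proof -
  have "(\<integral>t. (\<Sum>k. c k * cis (- t) ^ k) * g t \<partial>Leb) = (\<Sum>k. c k * (\<integral>t. cis (- t) ^ k * g t \<partial>Leb))"
    by (rule integral_suminf_bounded_mult[OF _ _ _ c])
      (use g in \<open>auto simp: L1T_def norm_power intro!: borel_measurable_Leb_continuous continuous_intros\<close>)
  moreover have "(\<Sum>k. c k * (\<integral>t. cis (- t) ^ k * g t \<partial>Leb)) = (\<Sum>k. c k * L1_coeff g k * of_real (2*pi))"
    by (simp add: L1_coeff_eq_pair L1_pair_def)
  moreover have "(\<Sum>k. c k * L1_coeff g k * of_real (2*pi)) = (\<Sum>k. c k * L1_coeff g k) * of_real (2*pi)"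
  proof (rule suminf_mult2[symmetric], rule summable_norm_cancel)
    show "summable (\<lambda>k. norm (c k * L1_coeff g k))"
      by (rule summable_comparison_test'[OF summable_mult2[OF c, of "L1_norm g"], of 0])
        (simp add: norm_mult mult_left_mono norm_L1_coeff_le[OF g])
  qed
  ultimately show ?thesis by (simp add: L1_pair_def)
qed

lemma taylor_coeff_power_series:
  assumes c: "summable (\<lambda>k. norm (c k))"
  shows "taylor_coeff (\<lambda>z. \<Sum>k. c k * z ^ k) j = c j"
proof -
  have "taylor_coeff (\<lambda>z. \<Sum>k. c k * z ^ k) j = (\<Sum>k. c k * L1_coeff (\<lambda>t. cis (of_int (int j) * t)) k)"
    unfolding taylor_coeff_eq_pair[OF power_series_disk_algebra[OF c]]
    using L1_pair_power_series[OF c L1T_cis(2), of j] by simp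
  also have "\<dots> = (\<Sum>k. if k = j then c k else 0)"
    unfolding L1_coeff_cis by (rule arg_cong[of _ _ suminf]) auto
  also have "\<dots> = c j" by (rule sums_unique[OF sums_single, symmetric])
  finally show ?thesis .
qed

lemma taylor_coeff_power: "taylor_coeff (\<lambda>z. z ^ k) j = (if j = k then 1 else 0)"
  unfolding taylor_coeff_eq_pair[OF disk_algebra_power] L1_coeff_eq_pair[symmetric]
  using L1_coeff_cis[of "int j" k] by simp

lemma L1_pair_trig_series:
  assumes b: "summable (\<lambda>k. norm (b k))" and f: "f \<in> disk_algebra"
  shows "L1_pair f (\<lambda>t. \<Sum>k. b k * cis (real k * t)) = (\<Sum>k. b k * taylor_coeff f k)"
proof -
  have "(\<integral>t. (\<Sum>k. b k * cis (real k * t)) * f (cis (- t)) \<partial>Leb)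
      = (\<Sum>k. b k * (\<integral>t. cis (real k * t) * f (cis (- t)) \<partial>Leb))"
    by (rule integral_suminf_bounded_mult[OF _ _ _ b])
      (use integrable_L1_pair[OF f L1T_cis(2), of 0] in
        \<open>auto intro!: borel_measurable_Leb_continuous continuous_intros\<close>)
  moreover have "(\<Sum>k. b k * (\<integral>t. cis (real k * t) * f (cis (- t)) \<partial>Leb)) = (\<Sum>k. b k * taylor_coeff f k * of_real (2*pi))"
    by (simp add: taylor_coeff_eq_pair[OF f] L1_pair_def mult.commute)
  moreover have "(\<Sum>k. b k * taylor_coeff f k * of_real (2*pi)) = (\<Sum>k. b k * taylor_coeff f k) * of_real (2*pi)"
  proof (rule suminf_mult2[symmetric], rule summable_norm_cancel)
    show "summable (\<lambda>k. norm (b k * taylor_coeff f k))"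
      by (rule summable_comparison_test'[OF summable_mult2[OF b, of "sup_norm f"], of 0])
        (simp add: norm_mult mult_left_mono norm_taylor_coeff_le[OF f])
  qed
  ultimately show ?thesis by (simp add: L1_pair_def mult.commute)
qed

text \<open>The Taylor polynomials of f itself need not converge uniformly. Those of a dilate f (r
  z) do, since its coefficients are at most a constant times r^k, and uniform continuity keeps the
  dilate close to f.\<close>

lemma disk_algebra_polynomial_approx:
  assumes f: "f \<in> disk_algebra" and e: "e > 0"
  shows "\<exists>c N. \<forall>z\<in>cball 0 1. norm (f z - (\<Sum>k<N. c k * z ^ k)) < e"
proof -
  have "uniformly_continuous_on (cball 0 1) f"
    using f by (intro compact_uniformly_continuous) (auto simp: disk_algebra_def)
  then obtain d where d: "d > 0" "\<And>x y. x \<in> cball 0 1 \<Longrightarrow> y \<in> cball 0 1 \<Longrightarrow> dist y x < d \<Longrightarrow> dist (f y) (f x) < e / 2"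
    unfolding uniformly_continuous_on_def using e by (metis half_gt_zero)
  \<comment> \<open>The maximum keeps r positive when d is large; in either case 1 - r \<le> d /
    2.\<close>
  define r where "r = max (1/2) (1 - d / 2)"
  have r: "0 < r" "r < 1" "1 - r < d" using d(1) by (auto simp: r_def)
  define c where "c k = taylor_coeff f k * of_real r ^ k" for k
  have "summable (\<lambda>k. norm (c k))"
    by (rule summable_comparison_test'[OF summable_mult[OF summable_geometric[of r], of "sup_norm f"], of 0])
      (use r in \<open>auto simp: c_def norm_mult norm_power mult_right_mono norm_taylor_coeff_le[OF f]\<close>)
  from uniform_limit_power_series[OF this]
  obtain N where N: "\<And>z. z \<in> cball 0 1 \<Longrightarrow> dist (\<Sum>k<N. c k * z ^ k) (\<Sum>k. c k * z ^ k) < e / 2"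
    unfolding uniform_limit_iff eventually_sequentially using e by (meson half_gt_zero order_refl)
  have "norm (f z - (\<Sum>k<N. c k * z ^ k)) < e" if z: "z \<in> cball 0 1" for z
  proof -
    have rz: "norm (of_real r * z) < 1"
      using z r by (simp add: norm_mult) (smt (verit) mult_left_le norm_ge_zero)
    then have "(\<lambda>k. taylor_coeff f k * (of_real r * z) ^ k) sums f (of_real r * z)"
      using holomorphic_power_series[of f 0 1 "of_real r * z"] f by (auto simp: disk_algebra_def taylor_coeff_def)
    then have "(\<Sum>k. c k * z ^ k) = f (of_real r * z)"
      by (simp add: c_def power_mult_distrib mult.assoc sums_iff)
    moreover have "dist (f (of_real r * z)) (f z) < e / 2"
    proof (rule d(2)[OF z])
      have "dist (of_real r * z) z = (1 - r) * norm z"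
      proof -
        have "of_real r * z - z = of_real (r - 1) * z" by (simp add: algebra_simps)
        then show ?thesis unfolding dist_norm using r by (simp only: norm_mult norm_of_real) simp
      qed
      also have "\<dots> \<le> 1 - r" using z r by (simp add: mult_left_le)
      finally show "dist (of_real r * z) z < d" using r by simp
    qed (use rz in auto)
    ultimately show ?thesis using N[OF z] unfolding dist_norm[symmetric]
      by (metis dist_commute dist_triangle_half_r)
  qed
  then show ?thesis by blast
qed

section \<open>Fejer kernels and Taylor multipliers\<close>

lemma one_plus_of_nat_neq_0 [simp]: "1 + (of_nat M :: complex) \<noteq> 0"
  using of_nat_neq_0[of M, where 'a = complex] by simp

section \<open>Completeness of the two spaces, in the form that Banach-Steinhaus asks for\<close>

lemma uniform_limit_disk_algebra:
  assumes F: "\<And>n. F n \<in> disk_algebra" and lim: "uniform_limit (cball 0 1) F f sequentially"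
  shows "f \<in> disk_algebra"
proof -
  have "\<forall>\<^sub>F n in sequentially. continuous_on (cball 0 1) (F n) \<and> F n holomorphic_on ball 0 1"
    using F by (simp add: disk_algebra_def)
  from holomorphic_uniform_limit[OF this lim] show ?thesis by (auto simp: disk_algebra_def)
qed

lemma uniform_limit_sup_norm:
  assumes F: "\<And>n. F n \<in> disk_algebra" and f: "f \<in> disk_algebra"
    and lim: "uniform_limit (cball 0 1) F f sequentially"
  shows "(\<lambda>n. sup_norm (\<lambda>z. f z - F n z)) \<longlonglongrightarrow> 0"
proof (rule LIMSEQ_I)
  fix e :: real assume e: "e > 0"
  obtain N where N: "\<And>n z. n \<ge> N \<Longrightarrow> z \<in> cball 0 1 \<Longrightarrow> dist (F n z) (f z) < e / 2"
    using lim e unfolding uniform_limit_iff eventually_sequentially by (meson half_gt_zero)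
  have "norm (sup_norm (\<lambda>z. f z - F n z) - 0) < e" if "n \<ge> N" for n
  proof -
    have "sup_norm (\<lambda>z. f z - F n z) \<le> e / 2"
      by (rule sup_norm_least) (use N[OF that] in \<open>auto simp: dist_norm norm_minus_commute less_imp_le\<close>)
    then show ?thesis using sup_norm_nonneg[OF disk_algebra_diff[OF f F]] e by simp
  qed
  then show "\<exists>no. \<forall>n\<ge>no. norm (sup_norm (\<lambda>z. f z - F n z) - 0) < e" by blast
qed

lemma disk_algebra_complete:
  assumes s: "\<And>j. s j \<in> disk_algebra"
    and d: "\<And>j. sup_norm (\<lambda>z. s (Suc j) z - s j z) \<le> (1/3) ^ j"
  shows "\<exists>f\<in>disk_algebra. (\<lambda>j. sup_norm (\<lambda>z. f z - s j z)) \<longlonglongrightarrow> 0"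
proof -
  have "uniform_limit (cball 0 1) (\<lambda>n z. \<Sum>j<n. s (Suc j) z - s j z)
      (\<lambda>z. \<Sum>j. s (Suc j) z - s j z) sequentially"
  proof (rule Weierstrass_m_test)
    show "norm (s (Suc j) z - s j z) \<le> (1/3) ^ j" if "z \<in> cball 0 1" for j z
      using norm_le_sup_norm[OF disk_algebra_diff[OF s s] that] d by (rule order_trans)
  qed (simp add: summable_geometric)
  from uniform_limit_add[OF uniform_limit_const this, of "s 0"]
  have lim: "uniform_limit (cball 0 1) s (\<lambda>z. s 0 z + (\<Sum>j. s (Suc j) z - s j z)) sequentially"
    by (simp add: sum_lessThan_telescope[of "\<lambda>j. s j _"])
  show ?thesis
    by (rule bexI, rule uniform_limit_sup_norm[OF s uniform_limit_disk_algebra[OF s lim] lim])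
      (rule uniform_limit_disk_algebra[OF s lim])
qed

lemma L1_norm_cmult: "L1_norm (\<lambda>t. c * g t) = norm c * L1_norm g"
  by (simp add: L1_norm_def norm_mult)

lemma L1_norm_triangle:
  assumes "L1T g" "L1T h" shows "L1_norm (\<lambda>t. g t + h t) \<le> L1_norm g + L1_norm h"
proof -
  have "(\<integral>t. norm (g t + h t) \<partial>Leb) \<le> (\<integral>t. norm (g t) + norm (h t) \<partial>Leb)"
    using assms unfolding L1T_def
    by (intro integral_mono Bochner_Integration.integrable_norm Bochner_Integration.integrable_add norm_triangle_ineq)
  also have "\<dots> = (\<integral>t. norm (g t) \<partial>Leb) + (\<integral>t. norm (h t) \<partial>Leb)"
    using assms unfolding L1T_def by (intro Bochner_Integration.integral_add Bochner_Integration.integrable_norm)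
  finally show ?thesis by (simp add: L1_norm_def add_divide_distrib[symmetric] divide_right_mono)
qed

lemma L1_norm_le_of_bounded:
  assumes g: "L1T g" and B: "\<And>t. t \<in> {0..2*pi} \<Longrightarrow> norm (g t) \<le> B"
  shows "L1_norm g \<le> B"
proof -
  interpret finite_measure Leb by (rule finite_measure_Leb)
  have "(\<integral>t. norm (g t) \<partial>Leb) \<le> (\<integral>t. B \<partial>Leb)"
    using g B unfolding L1T_def by (intro integral_mono Bochner_Integration.integrable_norm) auto
  then show ?thesis using measure_space_Leb by (simp add: L1_norm_def field_simps)
qed

text \<open>Riesz-Fischer for steps of geometric size. The sum D of the moduli of the steps is
  integrable, so the telescoping series converges almost everywhere and D dominates all remainders.
  On the exceptional null set the value of g is unspecified.\<close>

lemma L1_complete: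
  assumes s: "\<And>j. L1T (s j)"
    and d: "\<And>j. L1_norm (\<lambda>t. s (Suc j) t - s j t) \<le> (1/3) ^ j"
  shows "\<exists>g. L1T g \<and> (\<lambda>j. L1_norm (\<lambda>t. g t - s j t)) \<longlonglongrightarrow> 0"
proof -
  define \<delta> where "\<delta> j t = s (Suc j) t - s j t" for j t
  have int: "integrable Leb (\<delta> j)" for j
    using s unfolding \<delta>_def L1T_def by simp
  have sI: "summable (\<lambda>j. \<integral>t. norm (\<delta> j t) \<partial>Leb)"
  proof (rule summable_comparison_test'[of "\<lambda>j. (1/3) ^ j * (2*pi)" 0])
    show "norm (\<integral>t. norm (\<delta> j t) \<partial>Leb) \<le> (1/3) ^ j * (2*pi)" for j
      using d[of j] by (simp add: L1_norm_def \<delta>_def field_simps)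
  qed (intro summable_mult2 summable_geometric, simp)
  have "(\<integral>\<^sup>+t. (\<Sum>j. ennreal (norm (\<delta> j t))) \<partial>Leb) = (\<Sum>j. \<integral>\<^sup>+t. ennreal (norm (\<delta> j t)) \<partial>Leb)"
    using int by (intro nn_integral_suminf) auto
  also have "\<dots> = (\<Sum>j. ennreal (\<integral>t. norm (\<delta> j t) \<partial>Leb))"
    using int by (intro suminf_cong nn_integral_eq_integral) auto
  also have "\<dots> < \<infinity>"
    using sI by (simp add: less_top ennreal_suminf_neq_top)
  finally have "AE t in Leb. (\<Sum>j. ennreal (norm (\<delta> j t))) \<noteq> \<infinity>"
    using int by (intro nn_integral_PInf_AE) auto
  then have AEs: "AE t in Leb. summable (\<lambda>j. norm (\<delta> j t))"
    by eventually_elim (auto intro: summable_suminf_not_top)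
  define g where "g t = s 0 t + (\<Sum>j. \<delta> j t)" for t
  define D where "D t = (\<Sum>j. norm (\<delta> j t))" for t
  have g: "L1T g"
    using s[of 0] integrable_suminf[OF int AEs sI] unfolding L1T_def g_def by simp
  have AEn: "AE t in Leb. summable (\<lambda>j. norm (norm (\<delta> j t)))" using AEs by simp
  have D: "integrable Leb D"
    unfolding D_def using sI by (intro integrable_suminf[OF _ AEn]) (auto intro: int)
  have "(\<lambda>j. \<integral>t. norm (g t - s j t) \<partial>Leb) \<longlonglongrightarrow> (\<integral>t. 0 \<partial>Leb)"
  proof (rule integral_dominated_convergence[OF _ _ D])
    show "(\<lambda>t. norm (g t - s j t)) \<in> borel_measurable Leb" for j
      using g s[of j] unfolding L1T_def
      by (intro borel_measurable_integrable Bochner_Integration.integrable_norm Bochner_Integration.integrable_diff)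
    have s_eq: "g t - s j t = (\<Sum>i. \<delta> i t) - (\<Sum>i<j. \<delta> i t)" for j t
    proof -
      have "(\<Sum>i<j. \<delta> i t) = s j t - s 0 t"
        unfolding \<delta>_def by (rule sum_lessThan_telescope)
      then show ?thesis by (simp add: g_def)
    qed
    show "AE t in Leb. (\<lambda>j. norm (g t - s j t)) \<longlonglongrightarrow> 0"
      using AEs
    proof eventually_elim
      case (elim t)
      have "(\<lambda>j. norm ((\<Sum>i. \<delta> i t) - (\<Sum>i<j. \<delta> i t))) \<longlonglongrightarrow> norm ((\<Sum>i. \<delta> i t) - (\<Sum>i. \<delta> i t))"
        by (intro tendsto_intros summable_LIMSEQ summable_norm_cancel[OF elim])
      then show ?case by (simp add: s_eq)
    qed
    show "AE t in Leb. norm (norm (g t - s j t)) \<le> D t" for j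
      using AEs
    proof eventually_elim
      case (elim t)
      have "g t - s j t = (\<Sum>i. \<delta> (i + j) t)"
        unfolding s_eq suminf_minus_initial_segment[OF summable_norm_cancel[OF elim]] ..
      also have "norm \<dots> \<le> (\<Sum>i. norm (\<delta> (i + j) t))"
        by (rule summable_norm) (rule summable_ignore_initial_segment[OF elim])
      also have "\<dots> = D t - (\<Sum>i<j. norm (\<delta> i t))"
        unfolding D_def by (rule suminf_minus_initial_segment[OF elim])
      also have "\<dots> \<le> D t" by (simp add: sum_nonneg)
      finally show ?case by simp
    qed
  qed simp
  then have "(\<lambda>j. L1_norm (\<lambda>t. g t - s j t)) \<longlonglongrightarrow> 0 / (2*pi)"
    unfolding L1_norm_def by (intro tendsto_divide) auto
  with g show ?thesis by auto
qed

section \<open>Cesaro means, Fejer sums and the Fejer kernel\<close>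

lemma tail_tendsto_0:
  fixes b :: "nat \<Rightarrow> real"
  assumes "summable b" shows "(\<lambda>j. \<Sum>k. b (k + Suc j)) \<longlonglongrightarrow> 0"
proof -
  have "(\<lambda>j. suminf b - (\<Sum>k<Suc j. b k)) \<longlonglongrightarrow> suminf b - suminf b"
    by (intro tendsto_intros LIMSEQ_Suc summable_LIMSEQ assms)
  then show ?thesis by (simp only: suminf_minus_initial_segment[OF assms] diff_self)
qed

text \<open>The common rate at which the Cesaro means of all series dominated by b converge.\<close>
definition cesaro_error :: "(nat \<Rightarrow> complex) \<Rightarrow> nat \<Rightarrow> real" where
  "cesaro_error b M = (\<Sum>j\<le>M. \<Sum>k. norm (b (k + Suc j))) / real (M + 1)"

lemma cesaro_error_tendsto_0:
  assumes "summable (\<lambda>k. norm (b k))" shows "cesaro_error b \<longlonglongrightarrow> 0"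
  unfolding cesaro_error_def
proof (rule cesaro_mean_tendsto_0[OF tail_tendsto_0[OF assms]])
  show "0 \<le> (\<Sum>k. norm (b (k + Suc j)))" for j
    by (rule suminf_nonneg[OF summable_ignore_initial_segment[OF assms]]) simp
qed

lemma cesaro_partial_sums:
  fixes h b :: "nat \<Rightarrow> complex"
  assumes b: "summable (\<lambda>k. norm (b k))" and h: "\<And>k. norm (h k) \<le> norm (b k)"
  shows "norm ((\<Sum>j\<le>M. \<Sum>k\<le>j. h k) / of_nat (M + 1) - suminf h) \<le> cesaro_error b M"
proof -
  have sh: "summable (\<lambda>k. norm (h k))"
    by (rule summable_comparison_test'[OF b, of 0]) (use h in auto)
  have "(\<Sum>j\<le>M. \<Sum>k\<le>j. h k) / of_nat (M + 1) - suminf h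
      = (\<Sum>j\<le>M. (\<Sum>k\<le>j. h k) - suminf h) / of_nat (M + 1)"
    by (simp add: sum_subtractf diff_divide_distrib)
  also have "norm \<dots> = norm (\<Sum>j\<le>M. (\<Sum>k\<le>j. h k) - suminf h) / real (M + 1)"
    unfolding norm_divide by (simp only: norm_of_nat)
  also have "\<dots> \<le> cesaro_error b M"
    unfolding cesaro_error_def
  proof (intro divide_right_mono sum_norm_le)
    fix j
    have "norm ((\<Sum>k\<le>j. h k) - suminf h) = norm (\<Sum>k. h (k + Suc j))"
      unfolding suminf_minus_initial_segment[OF summable_norm_cancel[OF sh]] lessThan_Suc_atMost
      by (rule norm_minus_commute)
    also have "\<dots> \<le> (\<Sum>k. norm (h (k + Suc j)))"
      by (rule summable_norm) (rule summable_ignore_initial_segment[OF sh])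
    also have "\<dots> \<le> (\<Sum>k. norm (b (k + Suc j)))"
      by (rule suminf_le) (use h in \<open>auto intro: summable_ignore_initial_segment[OF sh, of "Suc j", simplified]
        summable_ignore_initial_segment[OF b, of "Suc j", simplified]\<close>)
    finally show "norm ((\<Sum>k\<le>j. h k) - suminf h) \<le> (\<Sum>k. norm (b (k + Suc j)))" .
  qed simp
  finally show ?thesis .
qed

text \<open>The Fejer mean of the formal series with coefficients b m over all integers m: for |m|
  \<le> M there are M + 1 - |m| pairs with j - l = m, which gives the usual triangular
  weights.\<close>

definition fejer_sum :: "nat \<Rightarrow> (int \<Rightarrow> complex) \<Rightarrow> real \<Rightarrow> complex" where
  "fejer_sum M b t = (\<Sum>j\<le>M. \<Sum>l\<le>M. b (int j - int l) * cis (of_int (int j - int l) * t)) / of_nat (M + 1)"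

lemma continuous_fejer_sum: "continuous_on S (fejer_sum M b)"
  unfolding fejer_sum_def by (intro continuous_intros) auto

lemma L1T_fejer_sum: "L1T (fejer_sum M b)"
  by (rule L1T_continuous[OF continuous_fejer_sum])

lemma L1T_sum: "(\<And>i. i \<in> I \<Longrightarrow> L1T (g i)) \<Longrightarrow> L1T (\<lambda>t. \<Sum>i\<in>I. c i * g i t)"
  by (simp add: L1T_def)

lemma L1_pair_sum_right:
  assumes f: "f \<in> disk_algebra" and I: "finite I" and g: "\<And>i. i \<in> I \<Longrightarrow> L1T (g i)"
  shows "L1_pair f (\<lambda>t. \<Sum>i\<in>I. c i * g i t) = (\<Sum>i\<in>I. c i * L1_pair f (g i))"
  using I g
proof (induction I rule: finite_induct)
  case empty
  then show ?case by (simp add: L1_pair_def)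
next
  case (insert i I)
  have "L1_pair f (\<lambda>t. (\<Sum>i\<in>I. c i * g i t) + c i * g i t) = L1_pair f (\<lambda>t. \<Sum>i\<in>I. c i * g i t) + c i * L1_pair f (g i)"
    by (rule L1_pair_comb_right[OF f]) (use insert.prems in \<open>auto intro: L1T_sum\<close>)
  then show ?case using insert by (simp add: add.commute)
qed

lemma L1_pair_fejer_sum:
  assumes f: "f \<in> disk_algebra"
  shows "L1_pair f (fejer_sum M b)
    = (\<Sum>j\<le>M. \<Sum>l\<le>M. b (int j - int l) * L1_pair f (\<lambda>t. cis (of_int (int j - int l) * t))) / of_nat (M + 1)"
proof -
  have e: "fejer_sum M b = (\<lambda>t. \<Sum>(j,l)\<in>{..M}\<times>{..M}. (b (int j - int l) / of_nat (M + 1)) * cis (of_int (int j - int l) * t))"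
    unfolding fejer_sum_def sum_divide_distrib sum.cartesian_product by (simp add: case_prod_beta)
  have "L1_pair f (fejer_sum M b) = (\<Sum>(j,l)\<in>{..M}\<times>{..M}. (b (int j - int l) / of_nat (M + 1)) * L1_pair f (\<lambda>t. cis (of_int (int j - int l) * t)))"
    unfolding e case_prod_beta
    by (rule L1_pair_sum_right[OF f]) (use L1T_cis(1)[of "int _ - int _"] in auto)
  then show ?thesis
    unfolding sum_divide_distrib sum.cartesian_product by (simp add: case_prod_beta)
qed

text \<open>For coefficients supported on nonnegative frequencies the double sum adds up partial
  sums, so a Fejer mean becomes a Cesaro mean.\<close>

lemma sum_diagonals:
  fixes h :: "nat \<Rightarrow> complex"
  shows "(\<Sum>j\<le>M. \<Sum>l\<le>M. if l \<le> j then h (j - l) else 0) = (\<Sum>j\<le>M. \<Sum>k\<le>j. h k)"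
proof (rule sum.cong[OF refl])
  fix j assume j: "j \<in> {..M}"
  have "(\<Sum>l\<le>M. if l \<le> j then h (j - l) else 0) = (\<Sum>l\<le>j. h (j - l))"
    by (rule sum.mono_neutral_cong_right) (use j in auto)
  also have "\<dots> = (\<Sum>k\<le>j. h k)"
    by (rule sum.reindex_bij_witness[of _ "\<lambda>k. j - k" "\<lambda>k. j - k"]) auto
  finally show "(\<Sum>l\<le>M. if l \<le> j then h (j - l) else 0) = (\<Sum>k\<le>j. h k)" .
qed

text \<open>Negative frequencies pair to 0 with the disk algebra, so only the
  \<open>b (int k)\<close> survive.\<close>

lemma L1_pair_power_series_fejer_sum:
  assumes c: "summable (\<lambda>k. norm (c k))"
  shows "L1_pair (\<lambda>z. \<Sum>k. c k * z ^ k) (fejer_sum M b)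
    = (\<Sum>j\<le>M. \<Sum>k\<le>j. b (int k) * c k) / of_nat (M + 1)"
proof -
  have p: "L1_pair (\<lambda>z. \<Sum>k. c k * z ^ k) (\<lambda>t. cis (of_int m * t)) = (if m \<ge> 0 then c (nat m) else 0)" for m
  proof -
    have "L1_pair (\<lambda>z. \<Sum>k. c k * z ^ k) (\<lambda>t. cis (of_int m * t)) = (\<Sum>k. if k = nat m then (if m \<ge> 0 then c k else 0) else 0)"
      unfolding L1_pair_power_series[OF c L1T_cis(1)] L1_coeff_cis
      by (rule arg_cong[of _ _ suminf]) (auto simp: fun_eq_iff)
    also have "\<dots> = (if m \<ge> 0 then c (nat m) else 0)" by (rule sums_unique[OF sums_single, symmetric])
    finally show ?thesis .
  qed
  have "(\<Sum>j\<le>M. \<Sum>l\<le>M. b (int j - int l) * L1_pair (\<lambda>z. \<Sum>k. c k * z ^ k) (\<lambda>t. cis (of_int (int j - int l) * t)))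
      = (\<Sum>j\<le>M. \<Sum>l\<le>M. if l \<le> j then b (int (j - l)) * c (j - l) else 0)"
    unfolding p by (intro sum.cong refl) (auto simp: of_nat_diff nat_diff_distrib)
  then show ?thesis
    unfolding L1_pair_fejer_sum[OF power_series_disk_algebra[OF c]] by (simp only: sum_diagonals[of "\<lambda>m. b (int m) * c m"])
qed

text \<open>The Fejer kernel at t + \<theta>. The sign is plus because \<open>L1_pair\<close>
  reflects t: pairing a power series with this kernel gives its Cesaro mean at cis \<theta>.\<close>

definition fejer_kernel :: "nat \<Rightarrow> real \<Rightarrow> real \<Rightarrow> complex" where
  "fejer_kernel M \<theta> = fejer_sum M (\<lambda>m. cis (of_int m * \<theta>))"

lemma L1T_fejer_kernel: "L1T (fejer_kernel M \<theta>)"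
  unfolding fejer_kernel_def by (rule L1T_fejer_sum)

text \<open>The double sum factors as D times its conjugate, with D a sum of M + 1 exponentials. In
  this form positivity lets the L1 norm be computed by integrating the kernel itself.\<close>

lemma fejer_kernel_eq_norm: "fejer_kernel M \<theta> t = of_real (norm (fejer_kernel M \<theta> t))"
proof -
  define D where "D = (\<Sum>j\<le>M. cis (real j * (t + \<theta>)))"
  have "fejer_kernel M \<theta> t = (\<Sum>j\<le>M. \<Sum>l\<le>M. cis (real j * (t + \<theta>)) * cnj (cis (real l * (t + \<theta>)))) / of_nat (M + 1)"
    unfolding fejer_kernel_def fejer_sum_def cis_cnj cis_mult
    by (intro arg_cong2[of _ _ _ _ "(/)"] sum.cong refl arg_cong[of _ _ cis]) (auto simp: algebra_simps)
  also have "\<dots> = D * cnj D / of_nat (M + 1)"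
    unfolding D_def cnj_sum sum_product ..
  also have "\<dots> = of_real ((norm D)\<^sup>2 / real (M + 1))"
    by (simp add: complex_norm_square[symmetric])
  finally have e: "fejer_kernel M \<theta> t = of_real ((norm D)\<^sup>2 / real (M + 1))" .
  show ?thesis unfolding e by (simp only: norm_of_real) (simp add: abs_mult)
qed

lemma integral_fejer_kernel: "(\<integral>t. fejer_kernel M \<theta> t \<partial>Leb) = of_real (2*pi)"
proof -
  \<comment> \<open>The constant 1 is written as a power series so that the pairing formula for
    Fejer sums yields the mean of the kernel.\<close>
  have "L1_pair (\<lambda>z. \<Sum>k. (if k = 0 then 1 else 0) * z ^ k) (fejer_kernel M \<theta>) = 1"
    unfolding fejer_kernel_def
    by (subst L1_pair_power_series_fejer_sum) (auto simp: if_distrib cong: if_cong)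
  moreover have "(\<Sum>k. (if k = 0 then 1 else 0) * z ^ k) = 1" for z :: complex
  proof -
    have "(\<lambda>k. (if k = 0 then 1 else 0) * z ^ k) = (\<lambda>k. if k = 0 then z ^ k else 0)" by auto
    then show ?thesis using sums_unique[OF sums_single[of 0 "\<lambda>k. z ^ k"]] by simp
  qed
  ultimately show ?thesis by (simp add: L1_pair_def)
qed

lemma L1_norm_fejer_kernel: "L1_norm (fejer_kernel M \<theta>) = 1"
proof -
  have "of_real (\<integral>t. norm (fejer_kernel M \<theta> t) \<partial>Leb) = (\<integral>t. fejer_kernel M \<theta> t \<partial>Leb)"
    unfolding integral_complex_of_real[symmetric] fejer_kernel_eq_norm[symmetric] ..
  then have "(\<integral>t. norm (fejer_kernel M \<theta> t) \<partial>Leb) = 2*pi"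
    unfolding integral_fejer_kernel by (simp only: of_real_eq_iff)
  then show ?thesis by (simp add: L1_norm_def)
qed

text \<open>A Cesaro mean at a boundary point is a pairing with a function of L1 norm 1, hence at
  most C; the Cesaro error vanishes in the limit, and maximum modulus fills the disk.\<close>

lemma norm_power_series_le_of_pair:
  assumes c: "summable (\<lambda>k. norm (c k))"
    and C: "\<And>g. L1T g \<Longrightarrow> norm (L1_pair (\<lambda>z. \<Sum>k. c k * z ^ k) g) \<le> C * L1_norm g"
    and z: "z \<in> cball 0 1"
  shows "norm (\<Sum>k. c k * z ^ k) \<le> C"
proof -
  have *: "norm (\<Sum>k. c k * cis \<theta> ^ k) \<le> C" for \<theta>
  proof (rule LIMSEQ_le_const[where X = "\<lambda>M. C + cesaro_error c M"])
    show "(\<lambda>M. C + cesaro_error c M) \<longlonglongrightarrow> C"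
      using tendsto_add[OF tendsto_const cesaro_error_tendsto_0[OF c], of C] by simp
    have "norm (\<Sum>k. c k * cis \<theta> ^ k) \<le> C + cesaro_error c M" for M
    proof -
      let ?P = "L1_pair (\<lambda>z. \<Sum>k. c k * z ^ k) (fejer_kernel M \<theta>)"
      let ?S = "(\<Sum>j\<le>M. \<Sum>k\<le>j. c k * cis \<theta> ^ k) / of_nat (M + 1)"
      have "norm (?S - (\<Sum>k. c k * cis \<theta> ^ k)) \<le> cesaro_error c M"
        by (rule cesaro_partial_sums[OF c]) (simp add: norm_mult norm_power)
      moreover have "?S = ?P"
        unfolding fejer_kernel_def L1_pair_power_series_fejer_sum[OF c]
        by (simp add: Complex.DeMoivre mult.commute)
      moreover have "norm ?P \<le> C"
        using C[OF L1T_fejer_kernel, of M \<theta>] unfolding L1_norm_fejer_kernel by simp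
      moreover have "norm y \<le> C + r" if "norm (x - y) \<le> r" "norm x \<le> C" for x y :: complex and r
        using that norm_triangle_ineq4[of x "x - y"] by simp
      ultimately show ?thesis by metis
    qed
    then show "\<exists>N. \<forall>n\<ge>N. norm (\<Sum>k. c k * cis \<theta> ^ k) \<le> C + cesaro_error c n" by blast
  qed
  show ?thesis
  proof (rule maximum_modulus_frontier[of "\<lambda>z. \<Sum>k. c k * z ^ k" "cball 0 1"])
    fix w :: complex assume "w \<in> frontier (cball 0 1)"
    then have "norm w = 1" by simp
    then have "w = cis (Arg w)" using rcis_cmod_Arg[of w] by (simp add: rcis_def)
    then show "norm (\<Sum>k. c k * w ^ k) \<le> C" using *[of "Arg w"] by simp
  qed (use power_series_disk_algebra[OF c] z in \<open>auto simp: disk_algebra_def\<close>)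
qed

section \<open>Taylor and Fourier multipliers and their uniform boundedness\<close>

definition mult_A :: "(nat \<Rightarrow> complex) \<Rightarrow> (complex \<Rightarrow> complex) \<Rightarrow> complex \<Rightarrow> complex" where
  "mult_A c f = (\<lambda>z. \<Sum>k. c k * taylor_coeff f k * z ^ k)"

definition mult_L1 :: "(nat \<Rightarrow> complex) \<Rightarrow> (real \<Rightarrow> complex) \<Rightarrow> real \<Rightarrow> complex" where
  "mult_L1 c g = (\<lambda>t. \<Sum>k. c k * L1_coeff g k * cis (real k * t))"

lemma summable_mult_bounded:
  fixes c d :: "nat \<Rightarrow> complex"
  assumes "summable (\<lambda>k. norm (c k))" "\<And>k. norm (d k) \<le> B"
  shows "summable (\<lambda>k. norm (c k * d k))"
  by (rule summable_comparison_test'[OF summable_mult2[OF assms(1), of B], of 0])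
    (use assms(2) in \<open>auto simp: norm_mult intro: mult_left_mono\<close>)

lemma continuous_trig_series:
  fixes b :: "nat \<Rightarrow> complex"
  assumes b: "summable (\<lambda>k. norm (b k))"
  shows "continuous_on S (\<lambda>t. \<Sum>k. b k * cis (real k * t))"
proof -
  have "continuous_on S (\<lambda>t. (\<lambda>z. \<Sum>k. b k * z ^ k) (cis t))"
    by (rule continuous_on_compose2[of "cball 0 1"])
      (use power_series_disk_algebra[OF b] in \<open>auto simp: disk_algebra_def intro!: continuous_intros\<close>)
  then show ?thesis by (simp add: Complex.DeMoivre)
qed

context
  fixes c :: "nat \<Rightarrow> complex"
  assumes c: "summable (\<lambda>k. norm (c k))"
begin

lemma summable_mult_A: "f \<in> disk_algebra \<Longrightarrow> summable (\<lambda>k. norm (c k * taylor_coeff f k))"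
  by (rule summable_mult_bounded[OF c norm_taylor_coeff_le])

lemma summable_mult_L1: "L1T g \<Longrightarrow> summable (\<lambda>k. norm (c k * L1_coeff g k))"
  by (rule summable_mult_bounded[OF c norm_L1_coeff_le])

lemma mult_A_disk_algebra: "f \<in> disk_algebra \<Longrightarrow> mult_A c f \<in> disk_algebra"
  unfolding mult_A_def by (intro power_series_disk_algebra summable_mult_A)

lemma L1T_mult_L1: "L1T g \<Longrightarrow> L1T (mult_L1 c g)"
  unfolding mult_L1_def by (rule L1T_continuous[OF continuous_trig_series[OF summable_mult_L1]])

text \<open>The two multipliers are adjoint: either pairing is the sum of c k times the Taylor
  coefficient times the Fourier coefficient. This moves bounds from one space to the other.\<close>

lemma L1_pair_mult_L1:
  assumes "f \<in> disk_algebra" "L1T g"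
  shows "L1_pair f (mult_L1 c g) = L1_pair (mult_A c f) g"
  unfolding mult_L1_def mult_A_def
    L1_pair_trig_series[OF summable_mult_L1[OF assms(2)] assms(1)]
    L1_pair_power_series[OF summable_mult_A[OF assms(1)] assms(2)]
  by (simp add: mult_ac)

text \<open>Restricted to the closed disk: outside it the series may diverge, and
  \<open>suminf\<close> is then not linear.\<close>

lemma mult_A_comb:
  assumes f: "f \<in> disk_algebra" and g: "g \<in> disk_algebra" and z: "z \<in> cball 0 1"
  shows "mult_A c (\<lambda>z. f z + d * g z) z = mult_A c f z + d * mult_A c g z"
proof -
  have s: "summable (\<lambda>k. c k * taylor_coeff h k * z ^ k)" if "h \<in> disk_algebra" for h
    using summable_norm_cancel[OF summable_power_series[OF summable_mult_A[OF that], of z]] z by simp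
  have "(\<lambda>k. c k * taylor_coeff f k * z ^ k + d * (c k * taylor_coeff g k * z ^ k))
      sums (mult_A c f z + d * mult_A c g z)"
    unfolding mult_A_def by (intro sums_add sums_mult summable_sums s f g)
  then show ?thesis
    unfolding mult_A_def taylor_coeff_comb[OF f g] by (simp add: sums_iff algebra_simps)
qed

lemma mult_A_polynomial:
  "mult_A c (\<lambda>z. \<Sum>k<N. p k * z ^ k) z = (\<Sum>k<N. c k * p k * z ^ k)"
proof -
  define q where "q k = (if k < N then p k else 0)" for k
  have q: "summable (\<lambda>k. norm (q k))"
    by (rule summable_finite[of "{..<N}"]) (auto simp: q_def)
  have fin: "(\<Sum>k. r k * q k * z ^ k) = (\<Sum>k<N. r k * p k * z ^ k)" for z r
    by (subst suminf_finite[of "{..<N}"]) (auto simp: q_def)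
  have e: "(\<lambda>z. \<Sum>k<N. p k * z ^ k) = (\<lambda>z. \<Sum>k. q k * z ^ k)"
    using fin[of "\<lambda>_. 1"] by simp
  show ?thesis
    unfolding e mult_A_def taylor_coeff_power_series[OF q] by (rule fin)
qed

end

lemma mult_A_uniformly_bounded:
  assumes summ: "\<And>n. summable (\<lambda>k. norm (a n k))"
    and conv: "\<And>g f. L1T g \<Longrightarrow> f \<in> disk_algebra \<Longrightarrow> (\<lambda>n. L1_pair f (mult_L1 (a n) g)) \<longlonglongrightarrow> L1_pair f g"
  shows "\<exists>C. \<forall>n. \<forall>f\<in>disk_algebra. \<forall>z\<in>cball 0 1. norm (mult_A (a n) f z) \<le> C * sup_norm f"
proof -
  \<comment> \<open>First application: g is fixed and the functionals on the disk algebra are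
    indexed by n. Their pointwise boundedness is the assumed convergence.\<close>
  have 1: "\<exists>C. \<forall>n. \<forall>f\<in>disk_algebra. norm (L1_pair f (mult_L1 (a n) g)) \<le> C * sup_norm f" if g: "L1T g" for g
  proof (rule uniform_boundedness)
    show "\<exists>K. \<forall>f\<in>disk_algebra. norm (L1_pair f (mult_L1 (a n) g)) \<le> K * sup_norm f" for n
      using norm_L1_pair_le_sup_norm[OF _ L1T_mult_L1[OF summ g], of _ n]
      by (intro exI[of _ "L1_norm (mult_L1 (a n) g)"]) (simp add: mult.commute)
    show "\<exists>B. \<forall>n. norm (L1_pair f (mult_L1 (a n) g)) \<le> B" if "f \<in> disk_algebra" for f
      using convergent_imp_Bseq[OF convergentI[OF conv[OF g that]]] by (auto simp: Bseq_def)
    show "L1_pair (\<lambda>t. x t + c * y t) (mult_L1 (a i) g) = L1_pair x (mult_L1 (a i) g) + c * L1_pair y (mult_L1 (a i) g)"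
      if "x \<in> disk_algebra" "y \<in> disk_algebra" for i c x y
      by (rule L1_pair_comb_left[OF that L1T_mult_L1[OF summ g]])
  qed (use disk_algebra_const disk_algebra_comb sup_norm_nonneg sup_norm_cmult sup_norm_triangle
      disk_algebra_complete in \<open>blast+\<close>)
  \<comment> \<open>Second application: the functionals act on L1 and are indexed by pairs of n and
    f in the closed unit ball, with value 0 for other f so that the index ranges over a whole type.
    Pointwise boundedness is the first bound, read through adjointness.\<close>
  define \<phi> where "\<phi> i g = (if snd i \<in> disk_algebra \<and> sup_norm (snd i) \<le> 1
      then L1_pair (mult_A (a (fst i)) (snd i)) g else 0)" for i g
  have "\<exists>C. \<forall>i. \<forall>g\<in>Collect L1T. norm (\<phi> i g) \<le> C * L1_norm g"
  proof (rule uniform_boundedness)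
    show "\<exists>x\<in>Collect L1T. (\<lambda>j. L1_norm (\<lambda>t. x t - s j t)) \<longlonglongrightarrow> 0"
      if "\<And>j. s j \<in> Collect L1T" "\<And>j. L1_norm (\<lambda>t. s (Suc j) t - s j t) \<le> (1/3) ^ j" for s
      using L1_complete[of s] that by simp
    show "\<exists>K. \<forall>g\<in>Collect L1T. norm (\<phi> i g) \<le> K * L1_norm g" for i
    proof (intro exI ballI)
      fix g assume "g \<in> Collect L1T"
      then have g: "L1T g" by simp
      show "norm (\<phi> i g) \<le> \<bar>sup_norm (mult_A (a (fst i)) (snd i))\<bar> * L1_norm g"
      proof (cases "snd i \<in> disk_algebra")
        case True
        have "norm (\<phi> i g) \<le> norm (L1_pair (mult_A (a (fst i)) (snd i)) g)" by (simp add: \<phi>_def)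
        also have "\<dots> \<le> sup_norm (mult_A (a (fst i)) (snd i)) * L1_norm g"
          by (rule norm_L1_pair_le_sup_norm[OF mult_A_disk_algebra[OF summ True] g])
        also have "\<dots> \<le> \<bar>sup_norm (mult_A (a (fst i)) (snd i))\<bar> * L1_norm g"
          by (intro mult_right_mono L1_norm_nonneg) simp
        finally show ?thesis .
      qed (simp add: \<phi>_def L1_norm_nonneg)
    qed
    show "\<exists>B. \<forall>i. norm (\<phi> i g) \<le> B" if "g \<in> Collect L1T" for g
    proof -
      have g: "L1T g" using that by simp
      obtain C where C: "\<And>n f. f \<in> disk_algebra \<Longrightarrow> norm (L1_pair f (mult_L1 (a n) g)) \<le> C * sup_norm f"
        using 1[OF g] by blast
      have "norm (\<phi> i g) \<le> \<bar>C\<bar>" for i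
      proof (cases "snd i \<in> disk_algebra \<and> sup_norm (snd i) \<le> 1")
        case True
        have "norm (\<phi> i g) \<le> C * sup_norm (snd i)"
          using True C[of "snd i" "fst i"] L1_pair_mult_L1[OF summ _ g] by (simp add: \<phi>_def)
        also have "\<dots> \<le> \<bar>C\<bar> * sup_norm (snd i)"
          using True by (intro mult_right_mono sup_norm_nonneg) auto
        also have "\<dots> \<le> \<bar>C\<bar>" using True by (simp add: mult_left_le)
        finally show ?thesis .
      qed (auto simp: \<phi>_def)
      then show ?thesis by blast
    qed
    show "\<phi> i (\<lambda>t. x t + c * y t) = \<phi> i x + c * \<phi> i y"
      if "x \<in> Collect L1T" "y \<in> Collect L1T" for i c x y
      using that L1_pair_comb_right[OF mult_A_disk_algebra[OF summ]] by (simp add: \<phi>_def)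
  qed (auto simp: L1T_comb L1_norm_nonneg L1_norm_cmult L1_norm_triangle L1T_def)
  then obtain C where C: "\<And>i g. L1T g \<Longrightarrow> norm (\<phi> i g) \<le> C * L1_norm g" by auto
  have unit: "norm (mult_A (a n) f z) \<le> C"
    if f: "f \<in> disk_algebra" "sup_norm f \<le> 1" and z: "z \<in> cball 0 1" for n f z
    unfolding mult_A_def
  proof (rule norm_power_series_le_of_pair[OF summable_mult_A[OF summ f(1)] _ z])
    show "norm (L1_pair (\<lambda>z. \<Sum>k. a n k * taylor_coeff f k * z ^ k) g) \<le> C * L1_norm g" if "L1T g" for g
      using C[OF that, of "(n, f)"] f by (simp add: \<phi>_def mult_A_def)
  qed
  have "norm (mult_A (a n) f z) \<le> C * sup_norm f" if f: "f \<in> disk_algebra" and z: "z \<in> cball 0 1" for n f z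
  proof (cases "sup_norm f = 0")
    \<comment> \<open>Such an f vanishes on the closed disk and cannot be normalised, but all its
      Taylor coefficients are 0.\<close>
    case True
    then have "taylor_coeff f k = 0" for k using norm_taylor_coeff_le[OF f, of k] by simp
    then show ?thesis using True by (simp add: mult_A_def)
  next
    case False
    then have pos: "sup_norm f > 0" using sup_norm_nonneg[OF f] by simp
    define d where "d = complex_of_real (1 / sup_norm f)"
    have "norm (mult_A (a n) (\<lambda>z. d * f z) z) \<le> C"
    proof (rule unit[OF disk_algebra_cmult[OF f] _ z])
      have "norm d = 1 / sup_norm f" unfolding d_def norm_of_real using pos by simp
      then show "sup_norm (\<lambda>z. d * f z) \<le> 1"
        unfolding sup_norm_cmult[OF f] using pos by simp
    qed
    moreover have "mult_A (a n) (\<lambda>z. d * f z) z = d * mult_A (a n) f z"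
      using mult_A_comb[OF summ[of n] disk_algebra_const[of 0] f z, where d = d]
        mult_A_polynomial[OF summ[of n], where N = 0] by simp
    moreover have "norm d = 1 / sup_norm f" unfolding d_def norm_of_real using pos by simp
    ultimately have "norm (mult_A (a n) f z) / sup_norm f \<le> C" by (simp add: norm_mult)
    then show ?thesis using pos by (simp add: pos_divide_le_eq)
  qed
  then show ?thesis by blast
qed

lemma multipliers_tendsto_1:
  assumes summ: "\<And>n. summable (\<lambda>k. norm (a n k))"
    and conv: "\<And>g f. L1T g \<Longrightarrow> f \<in> disk_algebra \<Longrightarrow> (\<lambda>n. L1_pair f (mult_L1 (a n) g)) \<longlonglongrightarrow> L1_pair f g"
  shows "(\<lambda>n. a n k) \<longlonglongrightarrow> 1"
proof -
  let ?g = "\<lambda>t. cis (of_int (int k) * t)"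
  have "L1_pair (\<lambda>z. z ^ k) (mult_L1 (a n) ?g) = a n k" for n
  proof -
    have "L1_pair (\<lambda>z. z ^ k) (mult_L1 (a n) ?g) = (\<Sum>j. if j = k then a n j else 0)"
      unfolding L1_pair_mult_L1[OF summ disk_algebra_power L1T_cis(1)] mult_A_def
      unfolding L1_pair_power_series[OF summable_mult_A[OF summ disk_algebra_power] L1T_cis(1)]
      unfolding L1_coeff_cis taylor_coeff_power
      by (rule arg_cong[of _ _ suminf]) auto
    also have "\<dots> = a n k" by (rule sums_unique[OF sums_single, symmetric])
    finally show ?thesis .
  qed
  moreover have "L1_pair (\<lambda>z. z ^ k) ?g = 1"
    using L1_coeff_cis[of "int k" k] unfolding L1_coeff_eq_pair by simp
  ultimately show ?thesis
    using conv[OF L1T_cis(1)[of "int k"] disk_algebra_power[of k]] by simp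
qed

lemma mult_A_uniform_limit:
  assumes summ: "\<And>n. summable (\<lambda>k. norm (a n k))"
    and one: "\<And>k. (\<lambda>n. a n k) \<longlonglongrightarrow> 1"
    and C: "\<And>n f z. f \<in> disk_algebra \<Longrightarrow> z \<in> cball 0 1 \<Longrightarrow> norm (mult_A (a n) f z) \<le> C * sup_norm f"
    and f: "f \<in> disk_algebra"
  shows "uniform_limit (cball 0 1) (\<lambda>n. mult_A (a n) f) f sequentially"
  unfolding uniform_limit_iff
proof (intro allI impI)
  fix e :: real assume e: "e > 0"
  \<comment> \<open>Replacing f by P costs at most \<bar>C\<bar> d + d = e / 2, and the finitely
    many multipliers acting on P cost the other half. \<bar>C\<bar> + 1 is positive whatever C
    is.\<close>
  define d where "d = e / (2 * (\<bar>C\<bar> + 1))"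
  have d: "d > 0" using e by (simp add: d_def)
  obtain p N where p: "\<And>z. z \<in> cball 0 1 \<Longrightarrow> norm (f z - (\<Sum>k<N. p k * z ^ k)) < d"
    using disk_algebra_polynomial_approx[OF f d] by blast
  define P where "P z = (\<Sum>k<N. p k * z ^ k)" for z
  have P: "P \<in> disk_algebra"
    unfolding P_def disk_algebra_def by (auto intro!: holomorphic_intros continuous_intros)
  have "(\<lambda>n. \<Sum>k<N. norm (a n k - 1) * norm (p k)) \<longlonglongrightarrow> (\<Sum>k<N. norm (1 - 1 :: complex) * norm (p k))"
    by (intro tendsto_intros one)
  then have "eventually (\<lambda>n. (\<Sum>k<N. norm (a n k - 1) * norm (p k)) < e / 2) sequentially"
    using e by (intro order_tendstoD(2)) auto
  then show "\<forall>\<^sub>F n in sequentially. \<forall>z\<in>cball 0 1. dist (mult_A (a n) f z) (f z) < e"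
  proof eventually_elim
    case (elim n)
    show ?case
    proof
      fix z :: complex assume z: "z \<in> cball 0 1"
      have "norm (mult_A (a n) (\<lambda>z. f z - P z) z) \<le> C * sup_norm (\<lambda>z. f z - P z)"
        by (rule C[OF disk_algebra_diff[OF f P] z])
      also have "\<dots> \<le> \<bar>C\<bar> * sup_norm (\<lambda>z. f z - P z)"
        by (intro mult_right_mono sup_norm_nonneg disk_algebra_diff[OF f P]) auto
      also have "\<dots> \<le> \<bar>C\<bar> * d"
        by (intro mult_left_mono sup_norm_least) (auto simp: P_def intro!: less_imp_le[OF p])
      finally have 1: "norm (mult_A (a n) (\<lambda>z. f z - P z) z) \<le> \<bar>C\<bar> * d" .
      have 2: "mult_A (a n) (\<lambda>z. f z - P z) z = mult_A (a n) f z - mult_A (a n) P z"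
        using mult_A_comb[OF summ[of n] f P z, where d = "-1"] by simp
      have "norm (mult_A (a n) P z - P z) = norm (\<Sum>k<N. (a n k - 1) * p k * z ^ k)"
        unfolding P_def mult_A_polynomial[OF summ] by (simp add: sum_subtractf algebra_simps)
      also have "\<dots> \<le> (\<Sum>k<N. norm (a n k - 1) * norm (p k))"
        by (rule sum_norm_le) (use z in \<open>auto simp: norm_mult norm_power mult_left_le power_le_one\<close>)
      finally have 3: "norm (mult_A (a n) P z - P z) < e / 2" using elim by simp
      have 4: "norm (f z - P z) < d" using p[OF z] by (simp add: P_def)
      have "mult_A (a n) f z - f z = (mult_A (a n) f z - mult_A (a n) P z) + (mult_A (a n) P z - P z) - (f z - P z)" by simp
      then have "norm (mult_A (a n) f z - f z) \<le> norm (mult_A (a n) f z - mult_A (a n) P z) + norm (mult_A (a n) P z - P z) + norm (f z - P z)"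
        by (smt (verit) norm_triangle_ineq norm_triangle_ineq4)
      also have "\<dots> < \<bar>C\<bar> * d + e / 2 + d" using 1 2 3 4 by simp
      also have "\<dots> = e"
      proof -
        have "d * (\<bar>C\<bar> + 1) = e / 2" by (simp add: d_def field_split_simps)
        then show ?thesis by (simp add: algebra_simps)
      qed
      finally show "dist (mult_A (a n) f z) (f z) < e" by (simp add: dist_norm)
    qed
  qed
qed

section \<open>The quotient norm and duality\<close>

lemma L1T_cmult: "L1T g \<Longrightarrow> L1T (\<lambda>t. c * g t)"
  unfolding L1T_def by simp

lemma H10_conjI: "L1T h \<Longrightarrow> (\<And>k. L1_coeff h k = 0) \<Longrightarrow> h \<in> H10_conj"
  by (simp add: H10_conj_def)

lemma H10_conj_L1T: "h \<in> H10_conj \<Longrightarrow> L1T h"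
  by (simp add: H10_conj_def)

lemma zero_H10_conj: "(\<lambda>t. 0) \<in> H10_conj"
  by (rule H10_conjI) (auto simp: L1T_def L1_coeff_def)

lemma H10_conj_comb:
  "g \<in> H10_conj \<Longrightarrow> h \<in> H10_conj \<Longrightarrow> (\<lambda>t. g t + c * h t) \<in> H10_conj"
  by (auto simp: H10_conj_def L1T_comb L1_coeff_comb)

lemma quot_norm_le: "h \<in> H10_conj \<Longrightarrow> quot_norm g \<le> L1_norm (\<lambda>t. g t - h t)"
  unfolding quot_norm_def by (rule cINF_lower) (auto intro!: bdd_belowI[of _ 0] L1_norm_nonneg)

lemma quot_norm_nonneg: "quot_norm g \<ge> 0"
  unfolding quot_norm_def by (rule cINF_greatest) (use zero_H10_conj in \<open>auto intro: L1_norm_nonneg\<close>)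

lemma quot_norm_le_L1_norm: "quot_norm g \<le> L1_norm g"
  using quot_norm_le[OF zero_H10_conj, of g] by simp

lemma quot_norm_approx:
  assumes "e > 0" shows "\<exists>h\<in>H10_conj. L1_norm (\<lambda>t. g t - h t) < quot_norm g + e"
proof -
  have "bdd_below ((\<lambda>h. L1_norm (\<lambda>t. g t - h t)) ` H10_conj)"
    by (auto intro!: bdd_belowI[of _ 0] L1_norm_nonneg)
  moreover have "H10_conj \<noteq> {}" using zero_H10_conj by auto
  ultimately show ?thesis
    using cINF_less_iff[of H10_conj "\<lambda>h. L1_norm (\<lambda>t. g t - h t)" "quot_norm g + e"] assms
    by (simp add: quot_norm_def)
qed

lemma quot_norm_comb:
  assumes g: "L1T g" and h: "L1T h"
  shows "quot_norm (\<lambda>t. g t + c * h t) \<le> quot_norm g + norm c * quot_norm h"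
proof (rule field_le_epsilon)
  fix e :: real assume e: "e > 0"
  \<comment> \<open>Each of the two near-minimisers may miss its infimum by d; their combination
    then misses by d + |c| d = e.\<close>
  define d where "d = e / (1 + norm c)"
  have "1 + norm c > 0" by (smt (verit) norm_ge_zero)
  then have "d * (1 + norm c) = e" "d > 0" using e by (simp_all add: d_def)
  then have d: "d > 0" "d + norm c * d = e" by (simp_all add: algebra_simps)
  obtain u where u: "u \<in> H10_conj" "L1_norm (\<lambda>t. g t - u t) < quot_norm g + d"
    using quot_norm_approx[OF d(1)] by blast
  obtain v where v: "v \<in> H10_conj" "L1_norm (\<lambda>t. h t - v t) < quot_norm h + d"
    using quot_norm_approx[OF d(1)] by blast
  have "quot_norm (\<lambda>t. g t + c * h t) \<le> L1_norm (\<lambda>t. g t + c * h t - (u t + c * v t))"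
    by (rule quot_norm_le[OF H10_conj_comb[OF u(1) v(1)]])
  also have "\<dots> = L1_norm (\<lambda>t. (g t - u t) + c * (h t - v t))"
    by (simp add: algebra_simps)
  also have "\<dots> \<le> L1_norm (\<lambda>t. g t - u t) + L1_norm (\<lambda>t. c * (h t - v t))"
    by (rule L1_norm_triangle)
      (intro L1T_cmult L1T_diff g h H10_conj_L1T u v)+
  also have "\<dots> \<le> (quot_norm g + d) + norm c * (quot_norm h + d)"
    unfolding L1_norm_cmult
    by (rule add_mono[OF less_imp_le[OF u(2)] mult_left_mono[OF less_imp_le[OF v(2)] norm_ge_zero]])
  also have "\<dots> = quot_norm g + norm c * quot_norm h + e"
    using d(2) by (simp add: algebra_simps)
  finally show "quot_norm (\<lambda>t. g t + c * h t) \<le> quot_norm g + norm c * quot_norm h + e" .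
qed

text \<open>h pairs to 0 with monomials by definition, and sup-norm continuity of the pairing
  extends this from polynomials to the disk algebra. Hence the pairing is well defined on
  classes.\<close>

lemma L1_pair_H10_conj:
  assumes f: "f \<in> disk_algebra" and h: "h \<in> H10_conj"
  shows "L1_pair f h = 0"
proof -
  have h': "L1T h" "\<And>k. L1_coeff h k = 0" using h by (auto simp: H10_conj_def)
  have le: "norm (L1_pair f h) \<le> e * L1_norm h" if e: "e > 0" for e
  proof -
    obtain p N where p: "\<And>z. z \<in> cball 0 1 \<Longrightarrow> norm (f z - (\<Sum>k<N. p k * z ^ k)) < e"
      using disk_algebra_polynomial_approx[OF f e] by blast
    define q where "q k = (if k < N then p k else 0)" for k
    have q: "summable (\<lambda>k. norm (q k))"
      by (rule summable_finite[of "{..<N}"]) (auto simp: q_def)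
    have qp: "(\<Sum>k. q k * z ^ k) = (\<Sum>k<N. p k * z ^ k)" for z
      by (subst suminf_finite[of "{..<N}"]) (auto simp: q_def)
    have "L1_pair (\<lambda>z. \<Sum>k. q k * z ^ k) h = 0"
      unfolding L1_pair_power_series[OF q h'(1)] h'(2) by simp
    then have "L1_pair f h = L1_pair (\<lambda>z. f z + (- 1) * (\<Sum>k. q k * z ^ k)) h"
      unfolding L1_pair_comb_left[OF f power_series_disk_algebra[OF q] h'(1)] by simp
    also have "norm \<dots> \<le> e * L1_norm h"
      by (rule norm_L1_pair_le[OF disk_algebra_comb[OF f power_series_disk_algebra[OF q]] h'(1)])
        (use p qp in \<open>auto intro!: less_imp_le\<close>)
    finally show ?thesis .
  qed
  have "norm (L1_pair f h) \<le> 0 + e" if "e > 0" for e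
  proof -
    have pos: "L1_norm h + 1 > 0" using L1_norm_nonneg[of h] by linarith
    then have "norm (L1_pair f h) \<le> e / (L1_norm h + 1) * L1_norm h"
      using le[of "e / (L1_norm h + 1)"] that by simp
    also have "\<dots> \<le> e" using that pos L1_norm_nonneg[of h] by (simp add: field_simps)
    finally show ?thesis by simp
  qed
  then have "norm (L1_pair f h) \<le> 0" by (rule field_le_epsilon)
  then show ?thesis by simp
qed

lemma norm_L1_pair_le_quot_norm:
  assumes f: "f \<in> disk_algebra" and g: "L1T g"
  shows "norm (L1_pair f g) \<le> sup_norm f * quot_norm g"
proof (rule field_le_epsilon)
  fix e :: real assume e: "e > 0"
  define d where "d = e / (sup_norm f + 1)"
  have pos: "sup_norm f + 1 > 0" using sup_norm_nonneg[OF f] by linarith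
  then have d: "d > 0" "sup_norm f * d \<le> e"
    using e sup_norm_nonneg[OF f] by (simp_all add: d_def field_simps)
  obtain h where h: "h \<in> H10_conj" "L1_norm (\<lambda>t. g t - h t) < quot_norm g + d"
    using quot_norm_approx[OF d(1)] by blast
  have "L1_pair f (\<lambda>t. g t - h t) = L1_pair f g"
    using L1_pair_comb_right[OF f g H10_conj_L1T[OF h(1)], of "- 1"] L1_pair_H10_conj[OF f h(1)] by simp
  then have "norm (L1_pair f g) \<le> sup_norm f * L1_norm (\<lambda>t. g t - h t)"
    using norm_L1_pair_le_sup_norm[OF f L1T_diff[OF g H10_conj_L1T[OF h(1)]]] by simp
  also have "\<dots> \<le> sup_norm f * (quot_norm g + d)"
    using h(2) sup_norm_nonneg[OF f] by (intro mult_left_mono) auto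
  finally show "norm (L1_pair f g) \<le> sup_norm f * quot_norm g + e"
    using d(2) by (simp add: algebra_simps)
qed

text \<open>The Hahn-Banach lemma needs a type that is a real vector space. The norm of bounded
  continuous functions is, on these periodic ones, the sup-norm over the circle.\<close>

definition cexp_bcont :: "complex \<Rightarrow> int \<Rightarrow> real \<Rightarrow>\<^sub>C complex" where
  "cexp_bcont c m = Bcontfun (\<lambda>t. c * cis (of_int m * t))"

lemma cexp_bcont_apply [simp]: "cexp_bcont c m t = c * cis (of_int m * t)"
proof -
  have "(\<lambda>t. c * cis (of_int m * t)) \<in> bcontfun"
    by (rule bcontfun_normI[of _ "norm c"]) (auto intro!: continuous_intros simp: norm_mult)
  then show ?thesis by (simp add: cexp_bcont_def Bcontfun_inverse)
qed

lemma sum_bcontfun_apply: "(\<Sum>i\<in>I. f i :: real \<Rightarrow>\<^sub>C complex) t = (\<Sum>i\<in>I. f i t)"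
  by (induction I rule: infinite_finite_induct) auto

text \<open>Reconciles two norms: the extension measures a polynomial on the circle, the disk
  algebra measures it on the closed disk.\<close>

lemma norm_polynomial_le:
  fixes p :: "nat \<Rightarrow> complex"
  assumes B: "\<And>t. norm (\<Sum>k\<le>M. p k * cis (real k * t)) \<le> B" and z: "z \<in> cball 0 1"
  shows "norm (\<Sum>k\<le>M. p k * z ^ k) \<le> B"
proof (rule maximum_modulus_frontier[of "\<lambda>z. \<Sum>k\<le>M. p k * z ^ k" "cball 0 1"])
  fix w :: complex assume "w \<in> frontier (cball 0 1)"
  then have "norm w = 1" by simp
  then have "w = cis (Arg w)" using rcis_cmod_Arg[of w] by (simp add: rcis_def)
  then have "w ^ k = cis (real k * Arg w)" for k by (metis Complex.DeMoivre)
  then show "norm (\<Sum>k\<le>M. p k * w ^ k) \<le> B" using B[of "Arg w"] by simp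
qed (use z in \<open>auto intro!: holomorphic_intros continuous_intros\<close>)

text \<open>The Hahn--Banach extension of the real part, from analytic polynomials to trigonometric
  polynomials of degree M; the complex coefficients are recovered from the real functional u as
  u(e) - i u(i e).\<close>
lemma extend_coefficients:
  fixes b :: "nat \<Rightarrow> complex"
  assumes C: "C \<ge> 0"
    and bound: "\<And>p. norm (\<Sum>k\<le>M. b k * p k) \<le> C * sup_norm (\<lambda>z. \<Sum>k\<le>M. p k * z ^ k)"
  shows "\<exists>b'. (\<forall>k\<le>M. b' (int k) = b k) \<and>
    (\<forall>x B. (\<forall>t. norm (\<Sum>j\<le>M. \<Sum>l\<le>M. x j l * cis (of_int (int j - int l) * t)) \<le> B) \<longrightarrow>
      Re (\<Sum>j\<le>M. \<Sum>l\<le>M. b' (int j - int l) * x j l) \<le> C * B)"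
proof -
  \<comment> \<open>Defined through Fourier coefficients, the functional is linear on all bounded
    continuous functions; the bound by C is established on S only.\<close>
  define u0 :: "(real \<Rightarrow>\<^sub>C complex) \<Rightarrow> real"
    where "u0 q = Re (\<Sum>k\<le>M. b k * L1_coeff q k)" for q
  have L1q: "L1T (apply_bcontfun q)" for q :: "real \<Rightarrow>\<^sub>C complex" by (rule L1T_continuous) simp
  have lin: "linear u0"
  proof (rule linearI)
    show "u0 (q + q') = u0 q + u0 q'" for q q'
      using L1_coeff_comb[OF L1q L1q, of q 1 q'] by (simp add: u0_def plus_bcontfun.rep_eq distrib_left sum.distrib)
    show "u0 (r *\<^sub>R q) = r *\<^sub>R u0 q" for r q
    proof -
      have z: "L1T (\<lambda>t. 0)" "L1_coeff (\<lambda>t. 0) k = 0" for k by (auto simp: L1T_def L1_coeff_def)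
      have "L1_coeff (r *\<^sub>R q) k = of_real r * L1_coeff q k" for k
        using L1_coeff_comb[OF z(1) L1q, of "of_real r" q k] by (simp add: z scaleR_bcontfun.rep_eq scaleR_conv_of_real)
      then show ?thesis by (simp add: u0_def mult.left_commute flip: sum_distrib_left)
    qed
  qed
  define S where "S = range (\<lambda>p. \<Sum>k\<le>M. cexp_bcont (p k) (int k))"
  have subS: "subspace S"
  proof (rule subspaceI)
    show "0 \<in> S"
      unfolding S_def by (rule range_eqI[of _ _ "\<lambda>_. 0"]) (auto intro!: bcontfun_eqI simp: sum_bcontfun_apply)
    show "x + y \<in> S" if xy: "x \<in> S" "y \<in> S" for x y
    proof -
      obtain p q where "x = (\<Sum>k\<le>M. cexp_bcont (p k) (int k))" "y = (\<Sum>k\<le>M. cexp_bcont (q k) (int k))"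
        using xy by (auto simp: S_def)
      then show ?thesis
        unfolding S_def by (intro range_eqI[of _ _ "\<lambda>k. p k + q k"] bcontfun_eqI)
          (auto simp: sum_bcontfun_apply plus_bcontfun.rep_eq distrib_right sum.distrib)
    qed
    show "r *\<^sub>R x \<in> S" if x: "x \<in> S" for r x
    proof -
      obtain p where "x = (\<Sum>k\<le>M. cexp_bcont (p k) (int k))" using x by (auto simp: S_def)
      then show ?thesis
        unfolding S_def by (intro range_eqI[of _ _ "\<lambda>k. r * p k"] bcontfun_eqI)
          (auto simp: sum_bcontfun_apply scaleR_bcontfun.rep_eq scaleR_conv_of_real sum_distrib_left mult.assoc)
    qed
  qed
  have coeff: "L1_coeff (\<Sum>k\<le>M. cexp_bcont (p k) (int k)) j = (if j \<le> M then p j else 0)" for p j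
  proof -
    have "L1_coeff (\<Sum>k\<le>M. cexp_bcont (p k) (int k)) j = L1_pair (\<lambda>z. z ^ j) (\<lambda>t. \<Sum>k\<le>M. p k * cis (of_int (int k) * t))"
      unfolding L1_coeff_eq_pair by (rule arg_cong[of _ _ "L1_pair _"]) (simp add: fun_eq_iff sum_bcontfun_apply)
    also have "\<dots> = (\<Sum>k\<le>M. p k * L1_coeff (\<lambda>t. cis (of_int (int k) * t)) j)"
      unfolding L1_coeff_eq_pair by (rule L1_pair_sum_right[OF disk_algebra_power]) (auto intro: L1T_cis)
    also have "\<dots> = (\<Sum>k\<le>M. if k = j then p k else 0)"
      unfolding L1_coeff_cis by (rule sum.cong) auto
    finally show ?thesis by simp
  qed
  have u0S: "u0 (\<Sum>k\<le>M. cexp_bcont (p k) (int k)) = Re (\<Sum>k\<le>M. b k * p k)" for p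
    unfolding u0_def coeff by simp
  have leS: "u0 q \<le> C * norm q" if "q \<in> S" for q
  proof -
    obtain p where q: "q = (\<Sum>k\<le>M. cexp_bcont (p k) (int k))" using \<open>q \<in> S\<close> by (auto simp: S_def)
    have "u0 q \<le> norm (\<Sum>k\<le>M. b k * p k)" unfolding q u0S by (rule complex_Re_le_cmod)
    also have "\<dots> \<le> C * sup_norm (\<lambda>z. \<Sum>k\<le>M. p k * z ^ k)" by (rule bound)
    also have "\<dots> \<le> C * norm q"
    proof (intro mult_left_mono sup_norm_least C norm_polynomial_le)
      show "norm (\<Sum>k\<le>M. p k * cis (real k * t)) \<le> norm q" for t
        using norm_bounded[of q t] by (simp add: q sum_bcontfun_apply)
    qed auto
    finally show ?thesis .
  qed
  \<comment> \<open>The negative frequencies to be added. The extension is only real linear, so each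
    frequency needs both directions e and i e.\<close>
  define V where "V = (\<lambda>(c, k). cexp_bcont c (- int k)) ` ({1, \<i>} \<times> {..M})"
  obtain u where u: "linear u" "\<And>x. x \<in> S \<Longrightarrow> u x = u0 x" "\<And>x. x \<in> span (V \<union> S) \<Longrightarrow> u x \<le> C * norm x"
  proof -
    have "\<exists>u'. linear u' \<and> (\<forall>x\<in>S. u' x = u0 x) \<and> (\<forall>x\<in>span (V \<union> S). u' x \<le> C * norm x)"
    proof (rule hahn_banach_finite[OF _ _ subS lin leS])
      show "C * norm (x + y) \<le> C * norm x + C * norm y" for x y :: "real \<Rightarrow>\<^sub>C complex"
        using mult_left_mono[OF norm_triangle_ineq C, of x y] by (simp add: distrib_left)
      show "finite V" by (simp add: V_def)
    qed auto
    then show thesis using that by blast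
  qed
  interpret u: linear u by (rule u(1))
  define b' where "b' m = Complex (u (cexp_bcont 1 m)) (- u (cexp_bcont \<i> m))" for m
  have split: "cexp_bcont c m = Re c *\<^sub>R cexp_bcont 1 m + Im c *\<^sub>R cexp_bcont \<i> m" for c m
  proof (rule bcontfun_eqI)
    have "c * w = of_real (Re c) * (1 * w) + of_real (Im c) * (\<i> * w)" for w
      by (subst complex_eq[of c]) (simp add: algebra_simps)
    then show "cexp_bcont c m t = (Re c *\<^sub>R cexp_bcont 1 m + Im c *\<^sub>R cexp_bcont \<i> m) t" for t
      by (simp add: plus_bcontfun.rep_eq scaleR_bcontfun.rep_eq scaleR_conv_of_real)
  qed
  have u_cexp: "u (cexp_bcont c m) = Re (b' m * c)" for c m
    by (subst split) (simp add: u.add u.scale b'_def)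
  have single: "cexp_bcont c (int k) = (\<Sum>j\<le>M. cexp_bcont (if j = k then c else 0) (int j))"
    if "k \<le> M" for c k
  proof (rule bcontfun_eqI)
    fix t
    have "(\<Sum>j\<le>M. (if j = k then c else 0) * cis (of_int (int j) * t)) = (\<Sum>j\<le>M. if j = k then c * cis (of_int (int k) * t) else 0)"
      by (rule sum.cong) auto
    then show "cexp_bcont c (int k) t = (\<Sum>j\<le>M. cexp_bcont (if j = k then c else 0) (int j)) t"
      using that by (simp add: sum_bcontfun_apply)
  qed
  have inS: "cexp_bcont c (int k) \<in> S" if "k \<le> M" for c k
    unfolding S_def by (rule range_eqI[of _ _ "\<lambda>j. if j = k then c else 0"]) (rule single[OF that])
  have in_span: "cexp_bcont c (int j - int l) \<in> span (V \<union> S)" if "j \<le> M" "l \<le> M" for c j l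
  proof (cases "l \<le> j")
    case True
    then have e: "int j - int l = int (j - l)" by simp
    show ?thesis unfolding e by (rule span_base[OF UnI2[OF inS]]) (use that in simp)
  next
    case False
    then have e: "int j - int l = - int (l - j)" by simp
    have V: "cexp_bcont d (int j - int l) \<in> span (V \<union> S)" if "d \<in> {1, \<i>}" for d
    proof -
      have "cexp_bcont d (int j - int l) \<in> V"
        unfolding e V_def by (rule image_eqI[of _ _ "(d, l - j)"]) (use that \<open>l \<le> M\<close> in auto)
      then show ?thesis by (rule span_base[OF UnI1])
    qed
    show ?thesis by (subst split, intro span_add span_scale V) auto
  qed
  have "b' (int k) = b k" if "k \<le> M" for k
  proof -
    have "u (cexp_bcont c (int k)) = Re (b k * c)" for c
    proof -
      have "(\<Sum>j\<le>M. b j * (if j = k then c else 0)) = (\<Sum>j\<le>M. if j = k then b k * c else 0)"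
        by (rule sum.cong) auto
      then have "(\<Sum>j\<le>M. b j * (if j = k then c else 0)) = b k * c" using that by simp
      then show ?thesis unfolding u(2)[OF inS[OF that]] unfolding single[OF that] u0S by simp
    qed
    from this[of 1] this[of \<i>] show ?thesis by (simp add: b'_def complex_eq_iff)
  qed
  \<comment> \<open>One frequency may occur in several terms x j l. This redundant form matches the
    double sums of Fejer means, and u sees only the resulting function.\<close>
  moreover have "Re (\<Sum>j\<le>M. \<Sum>l\<le>M. b' (int j - int l) * x j l) \<le> C * B"
    if B: "\<And>t. norm (\<Sum>j\<le>M. \<Sum>l\<le>M. x j l * cis (of_int (int j - int l) * t)) \<le> B" for x B
  proof -
    define q where "q = (\<Sum>j\<le>M. \<Sum>l\<le>M. cexp_bcont (x j l) (int j - int l))"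
    have "Re (\<Sum>j\<le>M. \<Sum>l\<le>M. b' (int j - int l) * x j l) = u q"
      unfolding q_def u.sum u_cexp Re_sum ..
    also have "\<dots> \<le> C * norm q"
      unfolding q_def by (intro u(3) span_sum in_span) auto
    also have "norm q \<le> B"
      by (rule norm_bound) (use B in \<open>simp add: q_def sum_bcontfun_apply\<close>)
    finally show ?thesis using C by (simp add: mult_left_mono)
  qed
  ultimately show ?thesis by blast
qed

text \<open>Only nonnegative indices of b occur, so changing b at negative indices alters a Fejer
  sum by an element of \<open>H10_conj\<close>.\<close>

lemma L1_coeff_fejer_sum:
  "L1_coeff (fejer_sum M b) k = (\<Sum>j\<le>M. \<Sum>i\<le>j. b (int i) * (if i = k then 1 else 0)) / of_nat (M + 1)"
proof -
  have q: "summable (\<lambda>i. norm (if i = k then 1 else 0 :: complex))"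
    by (rule summable_finite[of "{k}"]) auto
  have "(\<Sum>i. (if i = k then 1 else 0) * z ^ i) = z ^ k" for z :: complex
    by (subst suminf_finite[of "{k}"]) auto
  then show ?thesis
    using L1_pair_power_series_fejer_sum[OF q, of M b] by (simp add: L1_coeff_eq_pair)
qed

lemma integral_double_sum:
  fixes f :: "nat \<Rightarrow> nat \<Rightarrow> 'a \<Rightarrow> complex"
  assumes "\<And>j l. integrable M (f j l)"
  shows "(\<integral>t. (\<Sum>j\<in>J. \<Sum>l\<in>K. f j l t * c j l) \<partial>M) = (\<Sum>j\<in>J. \<Sum>l\<in>K. (\<integral>t. f j l t \<partial>M) * c j l)"
  using assms by simp

text \<open>The L1 norm is the integral of s against its conjugate phase U. The Fejer averaging can
  be moved from b to U, and since the kernel is positive with mean 1, the averaged U is a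
  trigonometric polynomial bounded by 1, to which the hypothesis applies.\<close>

lemma L1_norm_fejer_sum_le:
  assumes "\<And>x B. (\<And>t. norm (\<Sum>j\<le>M. \<Sum>l\<le>M. x j l * cis (of_int (int j - int l) * t)) \<le> B) \<Longrightarrow>
      Re (\<Sum>j\<le>M. \<Sum>l\<le>M. b (int j - int l) * x j l) \<le> C * B"
  shows "L1_norm (fejer_sum M b) \<le> C"
proof -
  define s where "s = fejer_sum M b"
  \<comment> \<open>Where s vanishes, division by 0 makes U equal to 0, so U is bounded by 1
    everywhere and U s = |s| holds without exception.\<close>
  define U where "U t = cnj (s t) / of_real (norm (s t))" for t
  have U_meas: "U \<in> borel_measurable Leb"
    unfolding U_def s_def
    by (intro borel_measurable_divide borel_measurable_Leb_continuous continuous_on_cnj continuous_on_of_real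
        continuous_on_norm continuous_fejer_sum)
  have U_le: "norm (U t) \<le> 1" for t by (simp add: U_def norm_divide)
  have U_s: "U t * s t = of_real (norm (s t))" for t
    by (cases "s t = 0") (auto simp: U_def field_simps complex_norm_square[symmetric] power2_eq_square simp del: of_real_mult simp flip: of_real_mult)
  have int: "integrable Leb (\<lambda>t. U t * cis (of_int m * t))" for m
    by (rule integrable_bounded_mult[OF _ U_meas U_le]) (use L1T_cis(1) in \<open>simp add: L1T_def\<close>)
  \<comment> \<open>Chosen so that the double sum at \<tau> is the mean of U against the Fejer
    kernel; 2 pi normalises the mean and M + 1 the Fejer sum.\<close>
  define x where "x j l = (\<integral>t. U t * cis (of_int (int j - int l) * t) \<partial>Leb) / of_real (2*pi) / of_nat (M + 1)" for j l
  have bound: "norm (\<Sum>j\<le>M. \<Sum>l\<le>M. x j l * cis (of_int (int j - int l) * \<tau>)) \<le> 1" for \<tau>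
  proof -
    have "(\<Sum>j\<le>M. \<Sum>l\<le>M. x j l * cis (of_int (int j - int l) * \<tau>))
      = (\<integral>t. (\<Sum>j\<le>M. \<Sum>l\<le>M. U t * cis (of_int (int j - int l) * t) * (cis (of_int (int j - int l) * \<tau>) / of_nat (M + 1))) \<partial>Leb) / of_real (2*pi)"
      unfolding integral_double_sum[OF int] x_def sum_divide_distrib
      by (intro sum.cong refl) (simp add: mult_ac)
    also have "(\<lambda>t. \<Sum>j\<le>M. \<Sum>l\<le>M. U t * cis (of_int (int j - int l) * t) * (cis (of_int (int j - int l) * \<tau>) / of_nat (M + 1)))
        = (\<lambda>t. U t * fejer_kernel M \<tau> t)"
      unfolding fejer_kernel_def fejer_sum_def by (simp add: sum_distrib_left sum_divide_distrib mult_ac)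
    also have "norm ((\<integral>t. U t * fejer_kernel M \<tau> t \<partial>Leb) / of_real (2*pi))
        \<le> 1 * (\<integral>t. norm (fejer_kernel M \<tau> t) \<partial>Leb) / (2*pi)"
      unfolding norm_divide
      using norm_integral_bounded_mult[OF _ U_meas U_le, of "fejer_kernel M \<tau>"] L1T_fejer_kernel[of M \<tau>]
      by (simp add: L1T_def divide_right_mono)
    also have "\<dots> = 1" using L1_norm_fejer_kernel[of M \<tau>] by (simp add: L1_norm_def)
    finally show ?thesis .
  qed
  have "complex_of_real (L1_norm s) = (\<integral>t. of_real (norm (s t)) \<partial>Leb) / of_real (2*pi)"
    by (simp add: L1_norm_def)
  also have "\<dots> = (\<integral>t. (\<Sum>j\<le>M. \<Sum>l\<le>M. U t * cis (of_int (int j - int l) * t) * (b (int j - int l) / of_nat (M + 1))) \<partial>Leb) / of_real (2*pi)"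
    unfolding U_s[symmetric] unfolding s_def fejer_sum_def by (simp add: sum_distrib_left sum_divide_distrib mult_ac)
  also have "\<dots> = (\<Sum>j\<le>M. \<Sum>l\<le>M. b (int j - int l) * x j l)"
    unfolding integral_double_sum[OF int] x_def sum_divide_distrib
    by (intro sum.cong refl) (simp add: mult_ac)
  finally have "L1_norm s = Re (\<Sum>j\<le>M. \<Sum>l\<le>M. b (int j - int l) * x j l)"
    by (metis Re_complex_of_real)
  also have "\<dots> \<le> C * 1" by (rule assms[OF bound])
  finally show ?thesis by (simp add: s_def)
qed

lemma quot_norm_le_functional_norm:
  assumes b: "summable (\<lambda>k. norm (b k))"
    and bound: "\<And>f. f \<in> disk_algebra \<Longrightarrow> norm (\<Sum>k. b k * taylor_coeff f k) \<le> C * sup_norm f"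
  shows "quot_norm (\<lambda>t. \<Sum>k. b k * cis (real k * t)) \<le> C"
proof -
  define F where "F t = (\<Sum>k. b k * cis (real k * t))" for t
  have F: "L1T F" unfolding F_def by (rule L1T_continuous[OF continuous_trig_series[OF b]])
  \<comment> \<open>Testing the bound on the constant 1 forces C \<ge> 0.\<close>
  have "sup_norm (\<lambda>z. 1) = 1" by (simp add: sup_norm_def)
  then have C: "C \<ge> 0" using order_trans[OF norm_ge_zero bound[OF disk_algebra_const[of 1]]] by simp
  have "quot_norm F \<le> C + cesaro_error b M" for M
  proof -
    have "norm (\<Sum>k\<le>M. b k * p k) \<le> C * sup_norm (\<lambda>z. \<Sum>k\<le>M. p k * z ^ k)" for p
    proof -
      define q where "q k = (if k \<le> M then p k else 0)" for k
      have q: "summable (\<lambda>k. norm (q k))"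
        by (rule summable_finite[of "{..M}"]) (auto simp: q_def)
      have fin: "(\<Sum>k. r k * q k * z ^ k) = (\<Sum>k\<le>M. r k * p k * z ^ k)" for z r
        by (subst suminf_finite[of "{..M}"]) (auto simp: q_def)
      have "(\<lambda>z. \<Sum>k. q k * z ^ k) = (\<lambda>z. \<Sum>k\<le>M. p k * z ^ k)" using fin[of "\<lambda>_. 1"] by simp
      then show ?thesis
        using bound[OF power_series_disk_algebra[OF q]] fin[of b 1]
        unfolding taylor_coeff_power_series[OF q] by simp
    qed
    from extend_coefficients[OF C this]
    obtain b' where b': "\<forall>k\<le>M. b' (int k) = b k"
      and ext: "\<forall>x B. (\<forall>t. norm (\<Sum>j\<le>M. \<Sum>l\<le>M. x j l * cis (of_int (int j - int l) * t)) \<le> B) \<longrightarrow>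
        Re (\<Sum>j\<le>M. \<Sum>l\<le>M. b' (int j - int l) * x j l) \<le> C * B"
      by (elim exE conjE) (rule that; assumption)
    \<comment> \<open>Extension of b by 0 gives the plain Cesaro mean of F, while b' gives the Fejer
      sum of controlled L1 norm. Their difference h lies in \<open>H10_conj\<close>, and F - h is
      the Cesaro error of F plus the Fejer sum of b'.\<close>
    define b'' where "b'' m = (if m \<ge> 0 then b (nat m) else 0)" for m
    define h where "h t = fejer_sum M b'' t - fejer_sum M b' t" for t
    have hL: "L1T h" unfolding h_def by (intro L1T_diff L1T_fejer_sum)
    have "L1_coeff h k = L1_coeff (fejer_sum M b'') k - L1_coeff (fejer_sum M b') k" for k
      using L1_coeff_comb[OF L1T_fejer_sum L1T_fejer_sum, of M b'' "- 1" M b' k] by (simp add: h_def[abs_def])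
    also have "\<dots> k = 0" for k
      unfolding L1_coeff_fejer_sum using b' by (simp add: b''_def)
    finally have h: "h \<in> H10_conj" using hL by (intro H10_conjI)
    have "fejer_sum M b'' t = (\<Sum>j\<le>M. \<Sum>k\<le>j. b k * cis (real k * t)) / of_nat (M + 1)" for t
    proof -
      have "(\<Sum>j\<le>M. \<Sum>l\<le>M. b'' (int j - int l) * cis (of_int (int j - int l) * t))
        = (\<Sum>j\<le>M. \<Sum>l\<le>M. if l \<le> j then b (j - l) * cis (real (j - l) * t) else 0)"
        by (intro sum.cong refl) (auto simp: b''_def nat_diff_distrib of_nat_diff)
      then show ?thesis unfolding fejer_sum_def by (simp only: sum_diagonals[of "\<lambda>k. b k * cis (real k * t)"])
    qed
    then have err: "norm (F t - fejer_sum M b'' t) \<le> cesaro_error b M" for t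
      using cesaro_partial_sums[OF b, of "\<lambda>k. b k * cis (real k * t)" M]
      by (simp add: F_def norm_mult norm_minus_commute)
    have "quot_norm F \<le> L1_norm (\<lambda>t. F t - h t)" by (rule quot_norm_le[OF h])
    also have "\<dots> = L1_norm (\<lambda>t. (F t - fejer_sum M b'' t) + fejer_sum M b' t)"
      by (simp add: h_def algebra_simps)
    also have "\<dots> \<le> L1_norm (\<lambda>t. F t - fejer_sum M b'' t) + L1_norm (fejer_sum M b')"
      by (intro L1_norm_triangle L1T_diff L1T_fejer_sum F)
    also have "\<dots> \<le> cesaro_error b M + C"
      by (intro add_mono L1_norm_le_of_bounded L1T_diff F L1T_fejer_sum err L1_norm_fejer_sum_le ext[rule_format])
    finally show ?thesis by simp
  qed
  then have "quot_norm F \<le> C + 0"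
    by (intro LIMSEQ_le_const[OF tendsto_add[OF tendsto_const cesaro_error_tendsto_0[OF b]]]) auto
  then show ?thesis by (simp add: F_def[abs_def])
qed

section \<open>Density of trigonometric polynomials in L1\<close>

text \<open>Closure rules instead of explicit coefficient sums: whatever is stable under
  \<open>p + c * q\<close> follows by induction from the exponentials.\<close>

inductive_set trig_poly :: "(real \<Rightarrow> complex) set" where
  cis: "(\<lambda>t. cis (of_int m * t)) \<in> trig_poly"
| comb: "p \<in> trig_poly \<Longrightarrow> q \<in> trig_poly \<Longrightarrow> (\<lambda>t. p t + c * q t) \<in> trig_poly"

lemma L1T_trig_poly: "p \<in> trig_poly \<Longrightarrow> L1T p"
  by (induction rule: trig_poly.induct) (auto intro: L1T_cis L1T_comb)

lemma trig_poly_add: "p \<in> trig_poly \<Longrightarrow> q \<in> trig_poly \<Longrightarrow> (\<lambda>t. p t + q t) \<in> trig_poly"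
  using trig_poly.comb[of p q 1] by simp

text \<open>\<open>comb\<close> fixes the first coefficient at 1, so c p arises as p + (c - 1)
  p.\<close>

lemma trig_poly_cmult: "p \<in> trig_poly \<Longrightarrow> (\<lambda>t. c * p t) \<in> trig_poly"
  using trig_poly.comb[of p p "c - 1"] by (simp add: algebra_simps)

lemma trig_poly_const: "(\<lambda>t. c) \<in> trig_poly"
  using trig_poly_cmult[OF trig_poly.cis[of 0], of c] by simp

lemma trig_poly_mult:
  assumes p: "p \<in> trig_poly" and q: "q \<in> trig_poly"
  shows "(\<lambda>t. p t * q t) \<in> trig_poly"
  using p
proof (induction rule: trig_poly.induct)
  case (cis m)
  show ?case using q
  proof (induction rule: trig_poly.induct)
    case (cis n)
    show ?case using trig_poly.cis[of "m + n"] by (simp add: cis_mult distrib_right)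
  next
    case (comb p q c)
    then show ?case using trig_poly.comb[OF comb.IH, of c] by (simp add: algebra_simps)
  qed
next
  case (comb p q c)
  then show ?case using trig_poly.comb[OF comb.IH, of c] by (simp add: algebra_simps)
qed

text \<open>On the circle a real linear function is A cos t + B sin t, a combination of two
  exponentials; sums and products are inherited. This translates the polynomials of
  Stone-Weierstrass into exponentials.\<close>

lemma trig_poly_real_polynomial_function:
  assumes "real_polynomial_function f"
  shows "(\<lambda>t. of_real (f (cis t))) \<in> trig_poly"
  using assms
proof (induction rule: real_polynomial_function.induct)
  case (linear f)
  interpret bounded_linear f by fact
  have "f (cis t) = cos t * f 1 + sin t * f \<i>" for t
  proof -
    have "cis t = cos t *\<^sub>R 1 + sin t *\<^sub>R \<i>" by (simp add: complex_eq_iff)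
    then show ?thesis by (simp only: add scaleR) simp
  qed
  moreover have "of_real (cos t * A + sin t * B) =
      (of_real A / 2 - \<i> * of_real B / 2) * cis (of_int 1 * t) + (of_real A / 2 + \<i> * of_real B / 2) * cis (of_int (- 1) * t)" for t A B
    by (simp add: complex_eq_iff field_simps)
  ultimately show ?case
    by (simp only:) (intro trig_poly_add trig_poly_cmult trig_poly.cis)
next
  case (const c) show ?case by (rule trig_poly_const)
next
  case (add f g) then show ?case using trig_poly_add by fastforce
next
  case (mult f g) then show ?case using trig_poly_mult by fastforce
qed

lemma trig_poly_polynomial_function:
  assumes p: "polynomial_function (p :: complex \<Rightarrow> complex)"
  shows "(\<lambda>t. p (cis t)) \<in> trig_poly"
proof -
  have "real_polynomial_function (Re \<circ> p)" "real_polynomial_function (Im \<circ> p)"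
    using p bounded_linear_Re bounded_linear_Im unfolding polynomial_function_def by blast+
  then have "(\<lambda>t. of_real ((Re \<circ> p) (cis t)) + \<i> * of_real ((Im \<circ> p) (cis t))) \<in> trig_poly"
    by (intro trig_poly.comb trig_poly_real_polynomial_function)
  then show ?thesis by (simp add: complex_eq[symmetric])
qed

text \<open>Equal endpoint values let u descend to a function F on the circle, where polynomial
  functions are uniformly dense.\<close>

lemma trig_poly_uniformly_dense:
  assumes u: "continuous_on {0..2*pi} u" "u 0 = u (2*pi)" and e: "e > 0"
  shows "\<exists>p\<in>trig_poly. \<forall>t\<in>{0..2*pi}. norm (u t - p t) < e"
proof -
  define F where "F z = u (Arg2pi z)" for z
  have F: "F (cis t) = u t" if t: "t \<in> {0..2*pi}" for t
  proof (cases "t = 2*pi")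
    case True
    then show ?thesis using u(2) using Arg2pi_of_real[of 1] by (simp add: F_def)
  next
    case False
    then have "Arg2pi (cis t) = t"
      using t by (intro Arg2pi_unique[of 1]) (auto simp: cis_conv_exp)
    then show ?thesis by (simp add: F_def)
  qed
  have surj: "\<exists>t\<in>{0..2*pi}. z = cis t" if "norm z = 1" for z
    by (intro bexI[of _ "Arg2pi z"])
      (use that Arg2pi_ge_0[of z] Arg2pi_lt_2pi[of z] complex_norm_eq_1_exp[of z] in \<open>auto simp: cis_conv_exp\<close>)
  \<comment> \<open>\<open>Arg2pi\<close> jumps at 1, so continuity is shown through closed sets: a
    preimage under F is the image under cis of a compact subset of the interval.\<close>
  have "continuous_on (sphere 0 1) F"
  proof (subst continuous_on_closed_vimage[OF closed_sphere], intro allI impI)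
    fix B :: "complex set" assume B: "closed B"
    have "closed (u -` B \<inter> {0..2*pi})"
      using u(1) B continuous_on_closed_vimage[of "{0..2*pi}" u] by auto
    then have "compact (u -` B \<inter> {0..2*pi})"
      by (meson bounded_closed_interval bounded_subset compact_eq_bounded_closed inf_le2)
    then have "compact (cis ` (u -` B \<inter> {0..2*pi}))"
      by (intro compact_continuous_image continuous_intros)
    moreover have "F -` B \<inter> sphere 0 1 = cis ` (u -` B \<inter> {0..2*pi})"
    proof
      show "F -` B \<inter> sphere 0 1 \<subseteq> cis ` (u -` B \<inter> {0..2*pi})"
      proof
        fix z assume z: "z \<in> F -` B \<inter> sphere 0 1"
        then obtain t where t: "t \<in> {0..2*pi}" "z = cis t" using surj[of z] by auto
        then show "z \<in> cis ` (u -` B \<inter> {0..2*pi})" using z F[OF t(1)] by auto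
      qed
    qed (use F in auto)
    ultimately show "closed (F -` B \<inter> sphere 0 1)" by (simp add: compact_imp_closed)
  qed
  then obtain p where p: "polynomial_function p" "\<And>z. z \<in> sphere 0 1 \<Longrightarrow> norm (F z - p z) < e"
    using Stone_Weierstrass_polynomial_function[OF compact_sphere _ e] by metis
  have "norm (u t - p (cis t)) < e" if "t \<in> {0..2*pi}" for t
    using p(2)[of "cis t"] F[OF that] by simp
  then show ?thesis by (intro bexI[OF _ trig_poly_polynomial_function[OF p(1)]] ballI)
qed

lemma L1_norm_tendsto_0:
  assumes g: "L1T g" and f: "\<And>n. L1T (f n)" and w: "integrable Leb w"
    and lim: "AE t in Leb. (\<lambda>n. f n t) \<longlonglongrightarrow> g t"
    and dom: "\<And>n t. t \<in> {0..2*pi} \<Longrightarrow> norm (g t - f n t) \<le> w t"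
  shows "(\<lambda>n. L1_norm (\<lambda>t. g t - f n t)) \<longlonglongrightarrow> 0"
proof -
  have "(\<lambda>n. \<integral>t. norm (g t - f n t) \<partial>Leb) \<longlonglongrightarrow> (\<integral>t. 0 \<partial>Leb)"
  proof (rule integral_dominated_convergence[OF _ _ w])
    show "(\<lambda>t. norm (g t - f n t)) \<in> borel_measurable Leb" for n
      using g f[of n] unfolding L1T_def
      by (intro borel_measurable_integrable Bochner_Integration.integrable_norm Bochner_Integration.integrable_diff)
    show "AE t in Leb. (\<lambda>n. norm (g t - f n t)) \<longlonglongrightarrow> 0"
      using lim
    proof eventually_elim
      case (elim t)
      have "(\<lambda>n. norm (g t - f n t)) \<longlonglongrightarrow> norm (g t - g t)" by (intro tendsto_intros elim)
      then show ?case by simp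
    qed
    show "AE t in Leb. norm (norm (g t - f n t)) \<le> w t" for n
      by (rule AE_I2) (use dom in auto)
  qed simp
  then have "(\<lambda>n. L1_norm (\<lambda>t. g t - f n t)) \<longlonglongrightarrow> 0 / (2*pi)"
    unfolding L1_norm_def by (intro tendsto_divide) auto
  then show ?thesis by simp
qed

lemma L1T_of_bounded:
  assumes "g \<in> borel_measurable Leb" "\<And>t. t \<in> {0..2*pi} \<Longrightarrow> norm (g t) \<le> B"
  shows "L1T g"
proof -
  interpret finite_measure Leb by (rule finite_measure_Leb)
  show ?thesis unfolding L1T_def
    by (rule integrable_const_bound[of _ B]) (use assms in auto)
qed

text \<open>Clipping at height m gives domination, and the cutoff near the endpoints periodicity.\<close>
lemma continuous_dense_bounded:
  assumes g: "g \<in> borel_measurable Leb" and m: "m > 0" "\<And>t. t \<in> {0..2*pi} \<Longrightarrow> norm (g t) \<le> m"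
    and e: "e > 0"
  shows "\<exists>v. continuous_on {0..2*pi} v \<and> v 0 = v (2*pi) \<and> L1_norm (\<lambda>t. g t - v t) < e"
proof -
  \<comment> \<open>This notion of measurability supplies continuous functions that converge to g
    off a negligible set.\<close>
  have "g measurable_on {0..2*pi}"
    using g by (subst measurable_on_iff_borel_measurable) auto
  then obtain N u where N: "negligible N" and u: "\<And>n::nat. continuous_on UNIV (u n)"
    and lim: "\<And>t. t \<notin> N \<Longrightarrow> (\<lambda>n. u n t) \<longlonglongrightarrow> (if t \<in> {0..2*pi} then g t else 0)"
    unfolding measurable_on_def by metis
  \<comment> \<open>The radial retraction onto the closed disk of radius m: it bounds the
    approximants and fixes the values of g.\<close>
  define clip :: "complex \<Rightarrow> complex" where "clip w = w * of_real (m / max m (norm w))" for w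
  have clip_cont: "continuous_on UNIV clip"
    unfolding clip_def using m(1) by (intro continuous_intros) (auto simp: max_def)
  have clip_le: "norm (clip w) \<le> m" for w
    using m(1) by (auto simp: clip_def norm_mult norm_divide max_def field_simps)
  have clip_id: "clip w = w" if "norm w \<le> m" for w
    using m(1) that by (simp add: clip_def max_def)
  define \<kappa> :: "nat \<Rightarrow> real \<Rightarrow> real" where "\<kappa> n t = min 1 (real n * min t (2*pi - t))" for n t
  define v where "v n t = of_real (\<kappa> n t) * clip (u n t)" for n t
  have \<kappa>: "\<bar>\<kappa> n t\<bar> \<le> 1" if "t \<in> {0..2*pi}" for n t
    using that by (auto simp: \<kappa>_def min_def)
  have v_cont: "continuous_on {0..2*pi} (v n)" for n
    unfolding v_def \<kappa>_def
    by (intro continuous_intros continuous_on_compose2[OF clip_cont] continuous_on_subset[OF u]) auto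
  have v_le: "norm (v n t) \<le> m" if "t \<in> {0..2*pi}" for n t
  proof -
    have "\<bar>\<kappa> n t\<bar> * norm (clip (u n t)) \<le> 1 * m"
      by (rule mult_mono[OF \<kappa>[OF that] clip_le]) auto
    then show ?thesis by (simp add: v_def norm_mult)
  qed
  have gL: "L1T g" by (rule L1T_of_bounded[OF g m(2)])
  have "(\<lambda>n. L1_norm (\<lambda>t. g t - v n t)) \<longlonglongrightarrow> 0"
  proof (rule L1_norm_tendsto_0[OF gL])
    show "L1T (v n)" for n by (rule L1T_continuous[OF v_cont])
    interpret finite_measure Leb by (rule finite_measure_Leb)
    show "integrable Leb (\<lambda>t. 2 * m)" by simp
    show "norm (g t - v n t) \<le> 2 * m" if "t \<in> {0..2*pi}" for n t
      using norm_triangle_ineq4[of "g t" "v n t"] m(2)[OF that] v_le[OF that, of n] by linarith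
    \<comment> \<open>The endpoints join the exceptional set because the cutoff is 0 there for every
      n.\<close>
    have "negligible (insert 0 (insert (2*pi) N))"
      using N by (simp add: negligible_insert)
    then have "AE t in lebesgue. t \<notin> insert 0 (insert (2*pi) N)"
      unfolding negligible_iff_null_sets by (rule AE_not_in)
    then have "AE t in Leb. t \<notin> insert 0 (insert (2*pi) N)"
      by (subst AE_restrict_space_iff) auto
    moreover have "AE t in Leb. t \<in> {0..2*pi}" by (rule AE_I2) simp
    ultimately show "AE t in Leb. (\<lambda>n. v n t) \<longlonglongrightarrow> g t"
    proof eventually_elim
      case (elim t)
      then have t: "0 < t" "t < 2*pi" "t \<notin> N" by auto
      have "(\<lambda>n. u n t) \<longlonglongrightarrow> g t" using lim[OF t(3)] elim by auto
      then have "(\<lambda>n. clip (u n t)) \<longlonglongrightarrow> clip (g t)"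
        using clip_cont by (auto intro!: continuous_on_tendsto_compose[of UNIV clip])
      moreover have "clip (g t) = g t" using clip_id m(2) elim by auto
      moreover have "(\<lambda>n. complex_of_real (\<kappa> n t)) \<longlonglongrightarrow> of_real 1"
      proof (intro tendsto_of_real tendsto_eventually)
        obtain K :: nat where K: "1 / min t (2*pi - t) < real K" using reals_Archimedean2 by blast
        have pos: "min t (2*pi - t) > 0" using t by simp
        have "\<kappa> n t = 1" if "n \<ge> K" for n
        proof -
          have "1 / min t (2*pi - t) \<le> real n" using K that by linarith
          then have "1 \<le> real n * min t (2*pi - t)" using pos by (simp add: pos_divide_le_eq)
          then show ?thesis by (simp add: \<kappa>_def)
        qed
        then show "\<forall>\<^sub>F n in sequentially. \<kappa> n t = 1" by (auto simp: eventually_sequentially)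
      qed
      ultimately have "(\<lambda>n. of_real (\<kappa> n t) * clip (u n t)) \<longlonglongrightarrow> of_real 1 * g t"
        by (intro tendsto_mult) auto
      then show ?case by (simp add: v_def)
    qed
  qed
  then obtain n where "L1_norm (\<lambda>t. g t - v n t) < e"
    using order_tendstoD(2)[OF _ e] by (metis (no_types, lifting) eventually_sequentially order_refl)
  moreover have "v n 0 = v n (2*pi)" by (simp add: v_def \<kappa>_def)
  ultimately show ?thesis using v_cont[of n] by blast
qed

lemma L1_norm_triangle3:
  assumes "L1T f" "L1T g" "L1T h"
  shows "L1_norm (\<lambda>t. f t - h t) \<le> L1_norm (\<lambda>t. f t - g t) + L1_norm (\<lambda>t. g t - h t)"
  using L1_norm_triangle[OF L1T_diff[OF assms(1,2)] L1T_diff[OF assms(2,3)]] by simp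

lemma trig_poly_dense_L1:
  assumes g: "L1T g" and e: "e > 0"
  shows "\<exists>p\<in>trig_poly. L1_norm (\<lambda>t. g t - p t) < e"
proof -
  define G where "G m t = (if norm (g t) \<le> real m then g t else 0)" for m t
  have g_meas: "g \<in> borel_measurable Leb" using g by (simp add: L1T_def)
  have G_meas: "G m \<in> borel_measurable Leb" for m
    unfolding G_def using g_meas by measurable
  \<comment> \<open>\<open>Suc m\<close> keeps the bound positive for m = 0, as clipping
    requires.\<close>
  have G_le: "norm (G m t) \<le> real (Suc m)" for m t by (simp add: G_def)
  have GL: "L1T (G m)" for m by (rule L1T_of_bounded[OF G_meas G_le])
  have "(\<lambda>m. L1_norm (\<lambda>t. g t - G m t)) \<longlonglongrightarrow> 0"
  proof (rule L1_norm_tendsto_0[OF g GL])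
    show "integrable Leb (\<lambda>t. norm (g t))" using g by (simp add: L1T_def)
    show "norm (g t - G m t) \<le> norm (g t)" for m t by (simp add: G_def)
    show "AE t in Leb. (\<lambda>m. G m t) \<longlonglongrightarrow> g t"
    proof (rule AE_I2, rule tendsto_eventually)
      fix t
      obtain K :: nat where "norm (g t) < real K" using reals_Archimedean2 by blast
      then have "G m t = g t" if "m \<ge> K" for m using that by (simp add: G_def)
      then show "\<forall>\<^sub>F m in sequentially. G m t = g t" by (auto simp: eventually_sequentially)
    qed
  qed
  then obtain m where m: "L1_norm (\<lambda>t. g t - G m t) < e / 3"
    using order_tendstoD(2)[of _ 0 sequentially "e / 3"] e
    by (metis (no_types, lifting) divide_pos_pos eventually_sequentially order_refl zero_less_numeral)
  obtain v where v: "continuous_on {0..2*pi} v" "v 0 = v (2*pi)" "L1_norm (\<lambda>t. G m t - v t) < e / 3"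
    using continuous_dense_bounded[OF G_meas _ G_le, of m "e / 3"] e by auto
  obtain p where p: "p \<in> trig_poly" "\<And>t. t \<in> {0..2*pi} \<Longrightarrow> norm (v t - p t) < e / 3"
    using trig_poly_uniformly_dense[OF v(1,2), of "e / 3"] e by auto
  have vL: "L1T v" by (rule L1T_continuous[OF v(1)])
  have pL: "L1T p" by (rule L1T_trig_poly[OF p(1)])
  have "L1_norm (\<lambda>t. v t - p t) \<le> e / 3"
    by (rule L1_norm_le_of_bounded[OF L1T_diff[OF vL pL]]) (rule less_imp_le[OF p(2)])
  then have "L1_norm (\<lambda>t. g t - p t) < e"
    using L1_norm_triangle3[OF g GL[of m] pL] L1_norm_triangle3[OF GL[of m] vL pL] m v(3) by linarith
  then show ?thesis using p(1) by blast
qed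

section \<open>Convergence of the multipliers in the quotient norm\<close>

lemma mult_L1_comb:
  assumes c: "summable (\<lambda>k. norm (c k))" and g: "L1T g" and h: "L1T h"
  shows "mult_L1 c (\<lambda>t. g t + d * h t) t = mult_L1 c g t + d * mult_L1 c h t"
proof -
  have s: "summable (\<lambda>k. c k * L1_coeff u k * cis (real k * t))" if "L1T u" for u
    using summable_norm_cancel[OF summable_power_series[OF summable_mult_L1[OF c that], of "cis t"]]
    by (simp add: Complex.DeMoivre)
  have "(\<lambda>k. c k * L1_coeff g k * cis (real k * t) + d * (c k * L1_coeff h k * cis (real k * t)))
      sums (mult_L1 c g t + d * mult_L1 c h t)"
    unfolding mult_L1_def by (intro sums_add sums_mult summable_sums s g h)
  then show ?thesis
    unfolding mult_L1_def L1_coeff_comb[OF g h] by (simp add: sums_iff algebra_simps)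
qed

lemma mult_L1_cis:
  "mult_L1 c (\<lambda>t. cis (of_int m * t)) = (\<lambda>t. if m \<ge> 0 then c (nat m) * cis (of_int m * t) else 0)"
proof
  fix t
  have "mult_L1 c (\<lambda>t. cis (of_int m * t)) t
      = (\<Sum>k. if k = nat m then (if m \<ge> 0 then c k * cis (real k * t) else 0) else 0)"
    unfolding mult_L1_def L1_coeff_cis by (rule arg_cong[of _ _ suminf]) (auto simp: fun_eq_iff)
  also have "\<dots> = (if m \<ge> 0 then c (nat m) * cis (real (nat m) * t) else 0)"
    by (rule sums_unique[OF sums_single, symmetric])
  finally show "mult_L1 c (\<lambda>t. cis (of_int m * t)) t = (if m \<ge> 0 then c (nat m) * cis (of_int m * t) else 0)"
    by simp
qed

lemma quot_norm_squeeze: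
  assumes "\<And>n. quot_norm (F n) \<le> y n" "y \<longlonglongrightarrow> 0"
  shows "(\<lambda>n. quot_norm (F n)) \<longlonglongrightarrow> 0"
  by (rule tendsto_sandwich[OF always_eventually always_eventually tendsto_const assms(2)])
    (simp_all add: quot_norm_nonneg assms(1))

lemma mult_L1_quot_norm_tendsto:
  assumes summ: "\<And>n. summable (\<lambda>k. norm (a n k))"
    and one: "\<And>k. (\<lambda>n. a n k) \<longlonglongrightarrow> 1"
    and C: "\<And>n f z. f \<in> disk_algebra \<Longrightarrow> z \<in> cball 0 1 \<Longrightarrow> norm (mult_A (a n) f z) \<le> C * sup_norm f"
    and g: "L1T g"
  shows "(\<lambda>n. quot_norm (\<lambda>t. mult_L1 (a n) g t - g t)) \<longlonglongrightarrow> 0"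
proof -
  \<comment> \<open>By adjointness, the uniform bound on the disk algebra bounds
    \<open>mult_L1 (a n) h\<close> as a functional by C times the L1 norm of h; the comparison of
    norms turns this into a bound on its class.\<close>
  have bound: "quot_norm (mult_L1 (a n) h) \<le> C * L1_norm h" if h: "L1T h" for n h
    unfolding mult_L1_def
  proof (rule quot_norm_le_functional_norm[OF summable_mult_L1[OF summ h]])
    fix f assume f: "f \<in> disk_algebra"
    have "(\<Sum>k. a n k * L1_coeff h k * taylor_coeff f k) = L1_pair (mult_A (a n) f) h"
      unfolding L1_pair_mult_L1[OF summ f h, symmetric] mult_L1_def
      by (rule L1_pair_trig_series[OF summable_mult_L1[OF summ h] f, symmetric])
    also have "norm \<dots> \<le> (C * sup_norm f) * L1_norm h"
      by (rule norm_L1_pair_le[OF mult_A_disk_algebra[OF summ f] h]) (simp add: C[OF f])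
    finally show "norm (\<Sum>k. a n k * L1_coeff h k * taylor_coeff f k) \<le> C * L1_norm h * sup_norm f"
      by (simp add: mult_ac)
  qed
  have trig: "(\<lambda>n. quot_norm (\<lambda>t. mult_L1 (a n) p t - p t)) \<longlonglongrightarrow> 0" if "p \<in> trig_poly" for p
    using that
  proof (induction rule: trig_poly.induct)
    case (cis m)
    let ?e = "\<lambda>t. cis (of_int m * t)"
    show ?case
    proof (cases "m \<ge> 0")
      case True
      have "quot_norm (\<lambda>t. mult_L1 (a n) ?e t - ?e t) \<le> norm (a n (nat m) - 1)" for n
      proof -
        have "(\<lambda>t. mult_L1 (a n) ?e t - ?e t) = (\<lambda>t. (a n (nat m) - 1) * ?e t)"
          using True by (simp add: mult_L1_cis left_diff_distrib)
        moreover have "L1_norm (\<lambda>t. (a n (nat m) - 1) * ?e t) = norm (a n (nat m) - 1)"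
          unfolding L1_norm_cmult using measure_space_Leb by (simp add: L1_norm_def)
        ultimately show ?thesis using quot_norm_le_L1_norm by metis
      qed
      moreover have "(\<lambda>n. norm (a n (nat m) - 1)) \<longlonglongrightarrow> 0"
        using one[of "nat m"] by (simp add: LIM_zero tendsto_norm_zero)
      ultimately show ?thesis by (rule quot_norm_squeeze)
    next
      case False
      \<comment> \<open>The multiplier kills a negative frequency, so the difference is minus the
        exponential, which represents the zero class.\<close>
      have "?e \<in> H10_conj"
        by (rule H10_conjI[OF L1T_cis(1)]) (use False in \<open>auto simp: L1_coeff_cis\<close>)
      from H10_conj_comb[OF zero_H10_conj this, of "- 1"]
      have "quot_norm (\<lambda>t. mult_L1 (a n) ?e t - ?e t) \<le> L1_norm (\<lambda>t. (mult_L1 (a n) ?e t - ?e t) - (- ?e t))" for n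
        by (intro quot_norm_le) simp
      then have "quot_norm (\<lambda>t. mult_L1 (a n) ?e t - ?e t) = 0" for n
        using False by (intro antisym quot_norm_nonneg) (simp add: mult_L1_cis L1_norm_def)
      then show ?thesis by simp
    qed
  next
    case (comb p q c)
    have L: "L1T p" "L1T q" using comb.hyps by (auto intro: L1T_trig_poly)
    have "quot_norm (\<lambda>t. mult_L1 (a n) (\<lambda>t. p t + c * q t) t - (p t + c * q t))
        \<le> quot_norm (\<lambda>t. mult_L1 (a n) p t - p t) + norm c * quot_norm (\<lambda>t. mult_L1 (a n) q t - q t)" for n
    proof -
      have eq: "(\<lambda>t. mult_L1 (a n) (\<lambda>t. p t + c * q t) t - (p t + c * q t))
          = (\<lambda>t. (mult_L1 (a n) p t - p t) + c * (mult_L1 (a n) q t - q t))"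
        unfolding mult_L1_comb[OF summ L] by (simp add: algebra_simps)
      show ?thesis unfolding eq
        by (rule quot_norm_comb[OF L1T_diff[OF L1T_mult_L1[OF summ L(1)] L(1)] L1T_diff[OF L1T_mult_L1[OF summ L(2)] L(2)]])
    qed
    moreover have "(\<lambda>n. quot_norm (\<lambda>t. mult_L1 (a n) p t - p t) + norm c * quot_norm (\<lambda>t. mult_L1 (a n) q t - q t)) \<longlonglongrightarrow> 0"
      using tendsto_add[OF comb.IH(1) tendsto_mult_left[OF comb.IH(2), of "norm c"]] by simp
    ultimately show ?case by (rule quot_norm_squeeze)
  qed
  show ?thesis
  proof (rule LIMSEQ_I)
    fix e :: real assume e: "e > 0"
    \<comment> \<open>The remainder g - p enters twice, through the multiplier with factor C and by
      itself, hence \<bar>C\<bar> + 1; the other e / 2 is left for p.\<close>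
    define d where "d = e / (2 * (\<bar>C\<bar> + 1))"
    have dC: "d * (\<bar>C\<bar> + 1) = e / 2" by (simp add: d_def field_split_simps)
    have d: "d > 0" using e by (simp add: d_def)
    obtain p where p: "p \<in> trig_poly" "L1_norm (\<lambda>t. g t - p t) < d"
      using trig_poly_dense_L1[OF g d] by blast
    have pL: "L1T p" by (rule L1T_trig_poly[OF p(1)])
    define r where "r t = g t - p t" for t
    have rL: "L1T r" unfolding r_def by (rule L1T_diff[OF g pL])
    obtain N where N: "\<And>n. n \<ge> N \<Longrightarrow> quot_norm (\<lambda>t. mult_L1 (a n) p t - p t) < e / 2"
      using LIMSEQ_D[OF trig[OF p(1)], of "e / 2"] e by (auto simp: quot_norm_nonneg)
    have "norm (quot_norm (\<lambda>t. mult_L1 (a n) g t - g t) - 0) < e" if n: "n \<ge> N" for n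
    proof -
      have gpr: "g = (\<lambda>t. p t + 1 * r t)" by (simp add: r_def)
      have "mult_L1 (a n) g t = mult_L1 (a n) p t + mult_L1 (a n) r t" for t
        by (subst gpr, subst mult_L1_comb[OF summ pL rL]) simp
      then have eq: "(\<lambda>t. mult_L1 (a n) g t - g t) = (\<lambda>t. (mult_L1 (a n) p t - p t) + 1 * (mult_L1 (a n) r t + (- 1) * r t))"
        by (simp add: r_def algebra_simps)
      have "quot_norm (\<lambda>t. mult_L1 (a n) g t - g t)
          \<le> quot_norm (\<lambda>t. mult_L1 (a n) p t - p t) + norm (1 :: complex) * quot_norm (\<lambda>t. mult_L1 (a n) r t + (- 1) * r t)"
        unfolding eq
        by (rule quot_norm_comb[OF L1T_diff[OF L1T_mult_L1[OF summ pL] pL] L1T_comb[OF L1T_mult_L1[OF summ rL] rL]])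
      also have "quot_norm (\<lambda>t. mult_L1 (a n) r t + (- 1) * r t) \<le> quot_norm (mult_L1 (a n) r) + norm (- 1 :: complex) * quot_norm r"
        by (rule quot_norm_comb[OF L1T_mult_L1[OF summ rL] rL])
      also have "\<dots> \<le> C * L1_norm r + L1_norm r"
        using bound[OF rL, of n] quot_norm_le_L1_norm[of r] by simp
      also have "\<dots> \<le> \<bar>C\<bar> * L1_norm r + L1_norm r"
        by (intro add_right_mono mult_right_mono L1_norm_nonneg) simp
      also have "\<dots> = L1_norm r * (\<bar>C\<bar> + 1)" by (simp add: algebra_simps)
      also have "\<dots> \<le> d * (\<bar>C\<bar> + 1)"
        by (intro mult_right_mono) (use p(2) in \<open>auto simp: r_def[abs_def]\<close>)
      finally have "quot_norm (\<lambda>t. mult_L1 (a n) g t - g t) < e"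
        using N[OF n] dC by simp
      then show ?thesis by (simp add: quot_norm_nonneg)
    qed
    then show "\<exists>no. \<forall>n\<ge>no. norm (quot_norm (\<lambda>t. mult_L1 (a n) g t - g t) - 0) < e" by blast
  qed
qed

section \<open>Measures on the circle\<close>

lemma cmeasure_T_measurable:
  assumes "cmeasure_T \<nu> h" "continuous_on (sphere 0 1) \<phi>"
  shows "\<phi> \<in> borel_measurable \<nu>"
proof -
  have "\<phi> \<in> borel_measurable (restrict_space borel (sphere 0 1))"
    by (rule borel_measurable_continuous_on_restrict[OF assms(2)])
  moreover have "sets \<nu> = sets (restrict_space borel (sphere 0 1))"
    using assms(1) by (simp add: cmeasure_T_def)
  ultimately show ?thesis
    using measurable_cong_sets[OF _ refl] by blast
qed

lemma cmeasure_T_space: "cmeasure_T \<nu> h \<Longrightarrow> space \<nu> = sphere 0 1"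
  using sets_eq_imp_space_eq[of \<nu> "restrict_space borel (sphere 0 1)"]
  by (simp add: cmeasure_T_def space_restrict_space)

context
  fixes \<nu> h assumes \<nu>: "cmeasure_T \<nu> h"
begin

lemma measurable_disk_algebra_cnj:
  assumes f: "f \<in> disk_algebra"
  shows "(\<lambda>\<zeta>. f (cnj \<zeta>)) \<in> borel_measurable \<nu>"
  by (rule cmeasure_T_measurable[OF \<nu>], rule continuous_on_compose2[of "cball 0 1" f])
    (use f in \<open>auto simp: disk_algebra_def intro!: continuous_intros\<close>)

lemma norm_disk_algebra_cnj_le:
  "f \<in> disk_algebra \<Longrightarrow> \<zeta> \<in> space \<nu> \<Longrightarrow> norm (f (cnj \<zeta>)) \<le> sup_norm f"
  by (rule norm_le_sup_norm) (auto simp: cmeasure_T_space[OF \<nu>])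

lemma bounded_functional_meas_pair: "bounded_functional_A (\<lambda>f. meas_pair f \<nu> h)"
proof -
  have h: "integrable \<nu> h" using \<nu> by (simp add: cmeasure_T_def)
  have int: "integrable \<nu> (\<lambda>\<zeta>. f (cnj \<zeta>) * h \<zeta>)" if "f \<in> disk_algebra" for f
    by (rule integrable_bounded_mult[OF h measurable_disk_algebra_cnj norm_disk_algebra_cnj_le]) (use that in auto)
  show ?thesis
    unfolding bounded_functional_A_def
  proof (intro conjI ballI allI)
    show "meas_pair (\<lambda>z. f z + g z) \<nu> h = meas_pair f \<nu> h + meas_pair g \<nu> h"
      if "f \<in> disk_algebra" "g \<in> disk_algebra" for f g
      using int that by (simp add: meas_pair_def distrib_right)
    show "meas_pair (\<lambda>z. c * f z) \<nu> h = c * meas_pair f \<nu> h" for c f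
      by (simp add: meas_pair_def mult.assoc)
    show "\<exists>C. \<forall>f\<in>disk_algebra. norm (meas_pair f \<nu> h) \<le> C * sup_norm f"
    proof (intro exI ballI)
      fix f assume f: "f \<in> disk_algebra"
      show "norm (meas_pair f \<nu> h) \<le> (\<integral>\<zeta>. norm (h \<zeta>) \<partial>\<nu>) * sup_norm f"
        using norm_integral_bounded_mult[OF h measurable_disk_algebra_cnj[OF f] norm_disk_algebra_cnj_le[OF f]]
        by (simp add: meas_pair_def mult.commute)
    qed
  qed
qed

text \<open>Adjointness for measures. It shows that condition (iii) is convergence in A(D) tested on
  the functionals that come from measures, which is how (i) implies it.\<close>

lemma L1_pair_meas_multiplier:
  assumes c: "summable (\<lambda>k. norm (c k))" and f: "f \<in> disk_algebra"
  shows "L1_pair f (\<lambda>t. \<Sum>k. c k * meas_coeff \<nu> h k * cis (real k * t)) = meas_pair (mult_A c f) \<nu> h"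
proof -
  have h: "integrable \<nu> h" using \<nu> by (simp add: cmeasure_T_def)
  have "norm (meas_coeff \<nu> h k) \<le> sup_norm (\<lambda>z. z ^ k) * (\<integral>\<zeta>. norm (h \<zeta>) \<partial>\<nu>)" for k
    unfolding meas_coeff_def
    by (rule norm_integral_bounded_mult[OF h measurable_disk_algebra_cnj[OF disk_algebra_power]
          norm_disk_algebra_cnj_le[OF disk_algebra_power]])
  moreover have "sup_norm (\<lambda>z. z ^ k) \<le> 1" for k
    by (rule sup_norm_least) (simp add: norm_power power_le_one)
  ultimately have "norm (meas_coeff \<nu> h k) \<le> 1 * (\<integral>\<zeta>. norm (h \<zeta>) \<partial>\<nu>)" for k
    by (rule order_trans[OF _ mult_right_mono]) simp
  then have s: "summable (\<lambda>k. norm (c k * meas_coeff \<nu> h k))"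
    by (rule summable_mult_bounded[OF c])
  have "meas_pair (mult_A c f) \<nu> h = (\<Sum>k. c k * taylor_coeff f k * (\<integral>\<zeta>. cnj \<zeta> ^ k * h \<zeta> \<partial>\<nu>))"
    unfolding meas_pair_def mult_A_def
    by (rule integral_suminf_bounded_mult[OF h measurable_disk_algebra_cnj[OF disk_algebra_power] _ summable_mult_A[OF c f]])
      (auto simp: cmeasure_T_space[OF \<nu>] norm_power)
  then show ?thesis
    unfolding L1_pair_trig_series[OF s f] by (simp add: meas_coeff_def mult_ac)
qed

end

lemma bounded_functional_A_tendsto:
  assumes L: "bounded_functional_A L" and F: "\<And>n. F n \<in> disk_algebra" and f: "f \<in> disk_algebra"
    and lim: "uniform_limit (cball 0 1) F f sequentially"
  shows "(\<lambda>n. L (F n)) \<longlonglongrightarrow> L f"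
proof -
  obtain C where C: "\<And>f. f \<in> disk_algebra \<Longrightarrow> norm (L f) \<le> C * sup_norm f"
    using L unfolding bounded_functional_A_def by blast
  have add: "L (\<lambda>z. u z + v z) = L u + L v" if "u \<in> disk_algebra" "v \<in> disk_algebra" for u v
    using L that unfolding bounded_functional_A_def by blast
  have diff: "L f - L (F n) = L (\<lambda>z. f z - F n z)" for n
    using add[OF disk_algebra_diff[OF f F] F, of n n] by simp
  have "(\<lambda>n. L f - L (F n)) \<longlonglongrightarrow> 0"
  proof (rule tendsto_norm_zero_cancel, rule tendsto_sandwich[OF always_eventually always_eventually tendsto_const])
    show "\<forall>n. norm (L f - L (F n)) \<le> C * sup_norm (\<lambda>z. f z - F n z)"
      unfolding diff by (intro allI C disk_algebra_diff f F)
    show "(\<lambda>n. C * sup_norm (\<lambda>z. f z - F n z)) \<longlonglongrightarrow> 0"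
      using tendsto_mult_left[OF uniform_limit_sup_norm[OF F f lim], of C] by simp
  qed simp
  from tendsto_diff[OF tendsto_const this, of "L f"] show ?thesis by simp
qed

text \<open>Encoding r in the measure, with constant density 1 on the circle, avoids choosing a Borel
  representative of a Lebesgue measurable function.\<close>
lemma L1_nonneg_as_cmeasure:
  fixes r :: "real \<Rightarrow> real"
  assumes r: "integrable Leb r" and nonneg: "\<And>t. r t \<ge> 0"
  shows "\<exists>\<nu>. cmeasure_T \<nu> (\<lambda>_. 1) \<and> (\<forall>k. meas_coeff \<nu> (\<lambda>_. 1) k = L1_coeff (\<lambda>t. of_real (r t)) k) \<and>
    (\<forall>f\<in>disk_algebra. meas_pair f \<nu> (\<lambda>_. 1) = L1_pair f (\<lambda>t. of_real (r t)))"
proof -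
  \<comment> \<open>The factor 1 / (2 pi) of normalised Lebesgue measure goes into the
    density.\<close>
  define w where "w t = r t / (2*pi)" for t
  have w_meas: "w \<in> borel_measurable Leb" and w_int: "integrable Leb w" and w_nonneg: "\<And>t. w t \<ge> 0"
    using r nonneg unfolding w_def[abs_def] by auto
  define D where "D = density Leb (\<lambda>t. ennreal (w t))"
  define S where "S = restrict_space borel (sphere (0::complex) 1)"
  define \<nu> where "\<nu> = distr D S cis"
  have "cis \<in> borel_measurable Leb"
    by (intro borel_measurable_Leb_continuous continuous_intros)
  then have cis: "cis \<in> measurable D S"
    unfolding D_def S_def by (intro measurable_restrict_space2) auto
  have D_fin: "emeasure D (space D) < \<infinity>"
  proof -
    have "emeasure D (space D) = (\<integral>\<^sup>+t. ennreal (w t) \<partial>Leb)"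
      unfolding D_def using w_meas by (subst emeasure_density) (auto intro!: nn_integral_cong)
    also have "\<dots> = ennreal (\<integral>t. w t \<partial>Leb)"
      by (rule nn_integral_eq_integral[OF w_int]) (use w_nonneg in auto)
    finally show ?thesis by simp
  qed
  interpret D: finite_measure D by (rule finite_measureI) (use D_fin in auto)
  have fin: "finite_measure \<nu>" unfolding \<nu>_def by (rule D.finite_measure_distr[OF cis])
  then have cm: "cmeasure_T \<nu> (\<lambda>_. 1)"
    unfolding cmeasure_T_def by (auto simp: \<nu>_def S_def finite_measure.integrable_const)
  have integral: "(\<integral>\<zeta>. \<phi> (cnj \<zeta>) \<partial>\<nu>) = (\<integral>t. \<phi> (cis (- t)) * of_real (r t) \<partial>Leb) / of_real (2*pi)"
    if \<phi>: "\<phi> \<in> disk_algebra" for \<phi>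
  proof -
    have "(\<lambda>\<zeta>. \<phi> (cnj \<zeta>)) \<in> borel_measurable S"
      using measurable_disk_algebra_cnj[OF cm \<phi>] by (simp add: \<nu>_def)
    then have "(\<integral>\<zeta>. \<phi> (cnj \<zeta>) \<partial>\<nu>) = (\<integral>t. \<phi> (cnj (cis t)) \<partial>D)"
      unfolding \<nu>_def by (rule integral_distr[OF cis])
    also have "\<dots> = (\<integral>t. w t *\<^sub>R \<phi> (cis (- t)) \<partial>Leb)"
      unfolding D_def cis_cnj
      by (rule integral_density[OF borel_measurable_disk_algebra_cis[OF \<phi>] w_meas]) (use w_nonneg in auto)
    also have "\<dots> = (\<integral>t. \<phi> (cis (- t)) * of_real (r t) / of_real (2*pi) \<partial>Leb)"
      by (simp add: w_def scaleR_conv_of_real mult.commute)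
    finally show ?thesis by simp
  qed
  have pair: "meas_pair \<phi> \<nu> (\<lambda>_. 1) = L1_pair \<phi> (\<lambda>t. of_real (r t))" if "\<phi> \<in> disk_algebra" for \<phi>
    using integral[OF that] by (simp add: meas_pair_def L1_pair_def)
  have "meas_coeff \<nu> (\<lambda>_. 1) k = L1_coeff (\<lambda>t. of_real (r t)) k" for k
    using pair[OF disk_algebra_power[of k]] by (simp add: meas_coeff_def meas_pair_def L1_coeff_eq_pair)
  with cm pair show ?thesis by blast
qed

lemma conv_L1_of_conv_measures:
  assumes summ: "\<And>n. summable (\<lambda>k. norm (a n k))"
    and conv: "\<And>\<nu> h f. cmeasure_T \<nu> h \<Longrightarrow> f \<in> disk_algebra \<Longrightarrow>
        (\<lambda>n. L1_pair f (\<lambda>t. \<Sum>k. a n k * meas_coeff \<nu> h k * cis (real k * t))) \<longlonglongrightarrow> meas_pair f \<nu> h"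
    and g: "L1T g" and f: "f \<in> disk_algebra"
  shows "(\<lambda>n. L1_pair f (mult_L1 (a n) g)) \<longlonglongrightarrow> L1_pair f g"
proof -
  \<comment> \<open>Stated through \<open>mult_A\<close>, the convergence is linear in u by
    linearity of the pairing alone; integrability is carried along so that P is closed under
    combinations.\<close>
  define P where "P u \<longleftrightarrow> L1T u \<and> (\<lambda>n. L1_pair (mult_A (a n) f) u) \<longlonglongrightarrow> L1_pair f u" for u
  have P_comb: "P (\<lambda>t. u t + c * v t)" if "P u" "P v" for u v c
    using that f L1_pair_comb_right[OF mult_A_disk_algebra[OF summ f], of u v _ c] L1_pair_comb_right[OF f, of u v c]
    by (auto simp: P_def L1T_comb intro!: tendsto_intros)
  have P_pos: "P (\<lambda>t. of_real (max 0 (r t)))" if r: "integrable Leb r" for r :: "real \<Rightarrow> real"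
  proof -
    have int: "integrable Leb (\<lambda>t. max 0 (r t))" using r by simp
    then obtain \<nu> where \<nu>: "cmeasure_T \<nu> (\<lambda>_. 1)"
      "\<And>k. meas_coeff \<nu> (\<lambda>_. 1) k = L1_coeff (\<lambda>t. of_real (max 0 (r t))) k"
      "meas_pair f \<nu> (\<lambda>_. 1) = L1_pair f (\<lambda>t. of_real (max 0 (r t)))"
      using L1_nonneg_as_cmeasure[of "\<lambda>t. max 0 (r t)"] f by auto
    have L: "L1T (\<lambda>t. of_real (max 0 (r t)))" unfolding L1T_def using int by (rule integrable_of_real)
    have "(\<lambda>n. L1_pair f (mult_L1 (a n) (\<lambda>t. of_real (max 0 (r t))))) \<longlonglongrightarrow> L1_pair f (\<lambda>t. of_real (max 0 (r t)))"
      using conv[OF \<nu>(1) f] unfolding \<nu>(2,3) mult_L1_def .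
    with L show ?thesis unfolding P_def L1_pair_mult_L1[OF summ f L] by blast
  qed
  have P_real: "P (\<lambda>t. of_real (r t))" if r: "integrable Leb r" for r :: "real \<Rightarrow> real"
  proof -
    have "P (\<lambda>t. of_real (max 0 (r t)) + (- 1) * of_real (max 0 (- r t)))"
      by (intro P_comb P_pos integrable_minus r)
    moreover have "(\<lambda>t. complex_of_real (max 0 (r t)) + (- 1) * of_real (max 0 (- r t))) = (\<lambda>t. of_real (r t))"
      by (auto simp: max_def)
    ultimately show ?thesis by simp
  qed
  have "P (\<lambda>t. of_real (Re (g t)) + \<i> * of_real (Im (g t)))"
    using g unfolding L1T_def by (intro P_comb P_real integrable_Re integrable_Im)
  then have "P g" by (simp add: complex_eq[symmetric])
  then show ?thesis by (simp add: P_def L1_pair_mult_L1[OF summ f g])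
qed

section \<open>The implications between the five conditions\<close>

theorem theorem4p4:
  fixes a :: "nat \<Rightarrow> nat \<Rightarrow> complex"
  assumes summ: "\<And>n. summable (\<lambda>k. norm (a n k))"
  shows
   "((\<forall>f\<in>disk_algebra.
        weakly_conv_A (\<lambda>n z. \<Sum>k. a n k * taylor_coeff f k * z ^ k) f)
     \<longleftrightarrow>
     (\<forall>f\<in>disk_algebra.
        uniform_limit (cball 0 1) (\<lambda>n z. \<Sum>k. a n k * taylor_coeff f k * z ^ k) f sequentially))
  \<and> ((\<forall>f\<in>disk_algebra.
        uniform_limit (cball 0 1) (\<lambda>n z. \<Sum>k. a n k * taylor_coeff f k * z ^ k) f sequentially)
     \<longleftrightarrow>
     (\<forall>\<nu> h. cmeasure_T \<nu> h \<longrightarrow> (\<forall>f\<in>disk_algebra.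
        (\<lambda>n. L1_pair f (\<lambda>t. \<Sum>k. a n k * meas_coeff \<nu> h k * cis (real k * t)))
          \<longlonglongrightarrow> meas_pair f \<nu> h)))
  \<and> ((\<forall>\<nu> h. cmeasure_T \<nu> h \<longrightarrow> (\<forall>f\<in>disk_algebra.
        (\<lambda>n. L1_pair f (\<lambda>t. \<Sum>k. a n k * meas_coeff \<nu> h k * cis (real k * t)))
          \<longlonglongrightarrow> meas_pair f \<nu> h))
     \<longleftrightarrow>
     (\<forall>g. L1T g \<longrightarrow> (\<forall>f\<in>disk_algebra.
        (\<lambda>n. L1_pair f (\<lambda>t. \<Sum>k. a n k * L1_coeff g k * cis (real k * t)))
          \<longlonglongrightarrow> L1_pair f g)))
  \<and> ((\<forall>g. L1T g \<longrightarrow> (\<forall>f\<in>disk_algebra.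
        (\<lambda>n. L1_pair f (\<lambda>t. \<Sum>k. a n k * L1_coeff g k * cis (real k * t)))
          \<longlonglongrightarrow> L1_pair f g))
     \<longleftrightarrow>
     (\<forall>g. L1T g \<longrightarrow>
        (\<lambda>n. quot_norm (\<lambda>t. (\<Sum>k. a n k * L1_coeff g k * cis (real k * t)) - g t))
          \<longlonglongrightarrow> 0))"
    (is "(?i \<longleftrightarrow> ?ii) \<and> (?ii \<longleftrightarrow> ?iii) \<and> (?iii \<longleftrightarrow> ?iv) \<and> (?iv \<longleftrightarrow> ?v)")
proof -
  have i: "?i \<longleftrightarrow> (\<forall>f\<in>disk_algebra. weakly_conv_A (\<lambda>n. mult_A (a n) f) f)"
    and ii: "?ii \<longleftrightarrow> (\<forall>f\<in>disk_algebra. uniform_limit (cball 0 1) (\<lambda>n. mult_A (a n) f) f sequentially)"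
    and iv: "?iv \<longleftrightarrow> (\<forall>g. L1T g \<longrightarrow> (\<forall>f\<in>disk_algebra. (\<lambda>n. L1_pair f (mult_L1 (a n) g)) \<longlonglongrightarrow> L1_pair f g))"
    and v: "?v \<longleftrightarrow> (\<forall>g. L1T g \<longrightarrow> (\<lambda>n. quot_norm (\<lambda>t. mult_L1 (a n) g t - g t)) \<longlonglongrightarrow> 0)"
    unfolding mult_A_def mult_L1_def by (rule refl)+
  have "?i" if ?ii
    unfolding i unfolding weakly_conv_A_def
  proof (intro ballI allI impI)
    fix f L assume f: "f \<in> disk_algebra" and L: "bounded_functional_A L"
    show "(\<lambda>n. L (mult_A (a n) f)) \<longlonglongrightarrow> L f"
      using that f unfolding ii
      by (intro bounded_functional_A_tendsto[OF L mult_A_disk_algebra[OF summ f] f]) blast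
  qed
  moreover have "?iii" if ?i
  proof (intro allI impI ballI)
    fix \<nu> h f assume \<nu>: "cmeasure_T \<nu> h" and f: "f \<in> disk_algebra"
    show "(\<lambda>n. L1_pair f (\<lambda>t. \<Sum>k. a n k * meas_coeff \<nu> h k * cis (real k * t))) \<longlonglongrightarrow> meas_pair f \<nu> h"
      unfolding L1_pair_meas_multiplier[OF \<nu> summ f]
      using that f bounded_functional_meas_pair[OF \<nu>] unfolding i unfolding weakly_conv_A_def by blast
  qed
  moreover have "?iv" if ?iii
    unfolding iv
  proof (intro allI impI ballI)
    fix g f assume "L1T g" "f \<in> disk_algebra"
    then show "(\<lambda>n. L1_pair f (mult_L1 (a n) g)) \<longlonglongrightarrow> L1_pair f g"
      using that by (intro conv_L1_of_conv_measures[where a = a, OF summ]) blast+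
  qed
  \<comment> \<open>(iv) is implied by each of the other conditions; its uniform bound and the
    limits of the multipliers serve (ii) and (v) alike.\<close>
  moreover have "?ii \<and> ?v" if ?iv
  proof -
    have conv: "\<And>g f. L1T g \<Longrightarrow> f \<in> disk_algebra \<Longrightarrow> (\<lambda>n. L1_pair f (mult_L1 (a n) g)) \<longlonglongrightarrow> L1_pair f g"
      using that unfolding iv by blast
    have one: "(\<lambda>n. a n k) \<longlonglongrightarrow> 1" for k
      by (rule multipliers_tendsto_1[where a = a, OF summ conv])
    obtain C where C: "\<And>n f z. f \<in> disk_algebra \<Longrightarrow> z \<in> cball 0 1 \<Longrightarrow> norm (mult_A (a n) f z) \<le> C * sup_norm f"
      using mult_A_uniformly_bounded[where a = a, OF summ conv] by blast
    show ?thesis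
      unfolding ii v
      using mult_A_uniform_limit[where a = a, OF summ one C] mult_L1_quot_norm_tendsto[where a = a, OF summ one C]
      by blast
  qed
  moreover have "?iv" if ?v
    unfolding iv
  proof (intro allI impI ballI)
    fix g f assume g: "L1T g" and f: "f \<in> disk_algebra"
    have eq: "L1_pair f (mult_L1 (a n) g) - L1_pair f g = L1_pair f (\<lambda>t. mult_L1 (a n) g t - g t)" for n
      using L1_pair_comb_right[OF f L1T_mult_L1[OF summ g] g, of n "- 1"] by simp
    have "(\<lambda>n. L1_pair f (mult_L1 (a n) g) - L1_pair f g) \<longlonglongrightarrow> 0"
    proof (rule tendsto_norm_zero_cancel, rule tendsto_sandwich[OF always_eventually always_eventually tendsto_const])
      show "\<forall>n. norm (L1_pair f (mult_L1 (a n) g) - L1_pair f g) \<le> sup_norm f * quot_norm (\<lambda>t. mult_L1 (a n) g t - g t)"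
        unfolding eq by (intro allI norm_L1_pair_le_quot_norm[OF f] L1T_diff L1T_mult_L1[OF summ] g)
      have "(\<lambda>n. quot_norm (\<lambda>t. mult_L1 (a n) g t - g t)) \<longlonglongrightarrow> 0"
        using that g unfolding v by blast
      then show "(\<lambda>n. sup_norm f * quot_norm (\<lambda>t. mult_L1 (a n) g t - g t)) \<longlonglongrightarrow> 0"
        using tendsto_mult_left[of _ 0 _ "sup_norm f"] by fastforce
    qed simp
    then show "(\<lambda>n. L1_pair f (mult_L1 (a n) g)) \<longlonglongrightarrow> L1_pair f g" by (rule LIM_zero_cancel)
  qed
  ultimately show ?thesis by argo
qed

end
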